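(* The differentials of the blocks of $S(\theta)=\begin{pmatrix}A(\theta)&\eta(\theta)\\ \eta(\theta)^\top&1\end{pmatrix}$ with respect to $\theta_j$ are $$\left[\frac{\partial A}{\partial\theta_j}\right]_{lm}=\mathbb{E}_{p_\theta}[u_ju_lu_m]-\mathbb{E}_{p_\theta}[u_j]\,\mathbb{E}_{p_\theta}[u_lu_m],\qquad \frac{\partial\eta}{\partial\theta_j}=I(\theta)\,\mathbf{e}_j,$$ where $\mathbf{e}_j$ is the $j$-th standard basis vector of $\mathbb{R}^d$, so that $d\eta=I(\theta)\,d\theta$. The pullback metric $g^{\mathcal{F}}$ on $\Theta$ has line element $$ds^2_{\mathcal{M}}=\tfrac12\,\mathrm{tr}(I^{-1}\,dA\,I^{-1}\,dA)-2\,\eta^\top I^{-1}\,dA\,I^{-1}\,d\eta+(\eta^\top I^{-1}\,d\eta)^2+\gamma\,(d\eta^\top I^{-1}\,d\eta),$$ where $\gamma=1+\eta^\top I^{-1}\eta$ and $dA=\sum_j\frac{\partial A}{\partial\theta_j}d\theta_j$.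
   Context: Let $(X,\mathcal{X},\mu)$ be a $\sigma$-finite measure space and let $\mathcal{M}_\mu$ be the set of measurable $p:X\to\mathbb{R}$ with $p>0$ $\mu$-a.e. and $\int_X p\,d\mu=1$. For $p\in\mathcal{M}_\mu$ write $\mathbb{E}_p[u]=\int_X u\,p\,d\mu$ (entrywise for matrices). Fix a reference density $p\in\mathcal{M}_\mu$. Let $B_p$ be the Banach space of ($\mu$-a.e. classes of) measurable $u:X\to\mathbb{R}$ such that $\mathbb{E}_p[\cosh(\alpha u)-1]<\infty$ for some $\alpha>0$ and $\mathbb{E}_p[u]=0$, with norm $\|u\|_p=\inf\{r>0:\mathbb{E}_p[\cosh(u/r)-1]\le 1\}$. For $u\in B_p$ let $K_p(u)=\log\mathbb{E}_p[e^u]\in[0,+\infty]$, $\mathrm{Dom}(K_p)=\{u\in B_p:K_p(u)<\infty\}$, with interior $\mathrm{Dom}(K_p)^\circ$ in $B_p$. Fix $d\ge 1$ and $u_1,\ldots,u_d\in B_p$ linearly independent in $L^2(p\cdot\mu)$ (standing assumption). Let $\Theta=\{\theta\in\mathbb{R}^d:\sum_j\theta_ju_j\in\mathrm{Dom}(K_p)^\circ\}$ (open), $\psi(\theta)=K_p(\sum_j\theta_ju_j)$, $p_\theta=e^{\sum_j\theta_ju_j-\psi(\theta)}p$, and $\mathcal{N}=\{p_\theta:\theta\in\Theta\}$. Put $\eta_j(\theta)=\mathbb{E}_{p_\theta}[u_j]$, $[A(\theta)]_{jk}=\mathbb{E}_{p_\theta}[u_ju_k]$, and $[I(\theta)]_{jk}=\mathrm{Cov}_{p_\theta}(u_j,u_k)$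 (Fisher information matrix, symmetric positive definite). $V(x)=(u_1(x),\ldots,u_d(x),1)^\top$ and $\mathcal{F}(p_\theta)=S(\theta)=\mathbb{E}_{p_\theta}[VV^\top]\in\mathrm{SPD}(d+1)$, where $\mathrm{SPD}(m)$ is the set of real symmetric positive definite $m\times m$ matrices. The affine-invariant Riemannian metric (AIRM) on $\mathrm{SPD}(m)$ is $\langle\Xi,\Omega\rangle_S=\frac12\mathrm{tr}(S^{-1}\Xi S^{-1}\Omega)$ for symmetric $\Xi,\Omega$. The pullback metric is $g^{\mathcal{F}}_{jk}(\theta)=\frac12\mathrm{tr}\left(S^{-1}\frac{\partial S}{\partial\theta_j}S^{-1}\frac{\partial S}{\partial\theta_k}\right)$ with line element $ds^2_{\mathcal{M}}=\sum_{j,k}g^{\mathcal{F}}_{jk}(\theta)\,d\theta_jd\theta_k=\frac12\mathrm{tr}((S^{-1}dS)^2)$. Here $d\theta=(d\theta_1,\dots,d\theta_d)^\top$ stands for a tangent vector, and $dA,d\eta,dS$ for the corresponding directional derivatives; the line element is a quadratic form in $d\theta$. *)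

theory Defs
  imports "HOL-Analysis.Analysis"
begin

definition densities :: "'a measure \<Rightarrow> ('a \<Rightarrow> real) set" where
  "densities M = {p \<in> borel_measurable M.
     (AE x in M. 0 < p x) \<and> integrable M p \<and> (\<integral>x. p x \<partial>M) = 1}"

definition expect :: "'a measure \<Rightarrow> ('a \<Rightarrow> real) \<Rightarrow> ('a \<Rightarrow> real) \<Rightarrow> real" where
  "expect M p f = (\<integral>x. f x * p x \<partial>M)"

text \<open>The expectation with values in \<open>[0,\<infinity>]\<close> of a nonnegative function.\<close>

definition nn_expect :: "'a measure \<Rightarrow> ('a \<Rightarrow> real) \<Rightarrow> ('a \<Rightarrow> real) \<Rightarrow> ennreal" where
  "nn_expect M p f = (\<integral>\<^sup>+x. ennreal (f x * p x) \<partial>M)"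

definition cov :: "'a measure \<Rightarrow> ('a \<Rightarrow> real) \<Rightarrow> ('a \<Rightarrow> real) \<Rightarrow> ('a \<Rightarrow> real) \<Rightarrow> real" where
  "cov M p f g = expect M p (\<lambda>x. (f x - expect M p f) * (g x - expect M p g))"


text \<open>Elements of the Banach space \<open>B\<^sub>p\<close> are represented by measurable functions; everything
  below depends only on their classes modulo almost everywhere equality. Measurable functions
  with a finite \<open>cosh\<close>-moment are integrable, so the Bochner integral in the centering
  condition is a genuine expectation.\<close>

definition orlicz_space :: "'a measure \<Rightarrow> ('a \<Rightarrow> real) \<Rightarrow> ('a \<Rightarrow> real) set" where
  "orlicz_space M p = {u \<in> borel_measurable M.
     (\<exists>\<alpha>>0. nn_expect M p (\<lambda>x. cosh (\<alpha> * u x) - 1) < \<infinity>) \<and> expect M p u = 0}"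

definition orlicz_norm :: "'a measure \<Rightarrow> ('a \<Rightarrow> real) \<Rightarrow> ('a \<Rightarrow> real) \<Rightarrow> real" where
  "orlicz_norm M p u = Inf {r. 0 < r \<and> nn_expect M p (\<lambda>x. cosh (u x / r) - 1) \<le> 1}"

definition cumulant :: "'a measure \<Rightarrow> ('a \<Rightarrow> real) \<Rightarrow> ('a \<Rightarrow> real) \<Rightarrow> ereal" where
  "cumulant M p u =
     (let m = nn_expect M p (\<lambda>x. exp (u x))
      in if m = \<infinity> then \<infinity> else ereal (ln (enn2real m)))"

definition cumulant_dom :: "'a measure \<Rightarrow> ('a \<Rightarrow> real) \<Rightarrow> ('a \<Rightarrow> real) set" where
  "cumulant_dom M p = {u \<in> orlicz_space M p. cumulant M p u < \<infinity>}"

text \<open>The interior is taken in \<open>B\<^sub>p\<close>, with respect to its norm.\<close>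

definition cumulant_dom_interior :: "'a measure \<Rightarrow> ('a \<Rightarrow> real) \<Rightarrow> ('a \<Rightarrow> real) set" where
  "cumulant_dom_interior M p = {u \<in> cumulant_dom M p.
     \<exists>\<epsilon>>0. \<forall>v \<in> orlicz_space M p. orlicz_norm M p (\<lambda>x. v x - u x) < \<epsilon> \<longrightarrow> v \<in> cumulant_dom M p}"


text \<open>Linear independence in \<open>L\<^sup>2(p \<cdot> \<mu>)\<close>: the zero vector is the class of functions vanishing
  almost everywhere with respect to \<open>p \<cdot> \<mu>\<close>.\<close>

definition lincomb :: "('d::finite \<Rightarrow> 'a \<Rightarrow> real) \<Rightarrow> real^'d \<Rightarrow> 'a \<Rightarrow> real" where
  "lincomb u \<theta> x = (\<Sum>j\<in>UNIV. \<theta>$j * u j x)"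

definition lin_indep_L2 :: "'a measure \<Rightarrow> ('a \<Rightarrow> real) \<Rightarrow> ('d::finite \<Rightarrow> 'a \<Rightarrow> real) \<Rightarrow> bool" where
  "lin_indep_L2 M p u \<longleftrightarrow>
     (\<forall>c. (AE x in density M (\<lambda>x. ennreal (p x)). lincomb u c x = 0) \<longrightarrow> c = 0)"

definition param_space :: "'a measure \<Rightarrow> ('a \<Rightarrow> real) \<Rightarrow> ('d::finite \<Rightarrow> 'a \<Rightarrow> real) \<Rightarrow> (real^'d) set" where
  "param_space M p u = {\<theta>. lincomb u \<theta> \<in> cumulant_dom_interior M p}"

definition log_partition :: "'a measure \<Rightarrow> ('a \<Rightarrow> real) \<Rightarrow> ('d::finite \<Rightarrow> 'a \<Rightarrow> real) \<Rightarrow> real^'d \<Rightarrow> real" where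
  "log_partition M p u \<theta> = real_of_ereal (cumulant M p (lincomb u \<theta>))"

definition exp_density ::
  "'a measure \<Rightarrow> ('a \<Rightarrow> real) \<Rightarrow> ('d::finite \<Rightarrow> 'a \<Rightarrow> real) \<Rightarrow> real^'d \<Rightarrow> 'a \<Rightarrow> real" where
  "exp_density M p u \<theta> x = exp (lincomb u \<theta> x - log_partition M p u \<theta>) * p x"

definition eta :: "'a measure \<Rightarrow> ('a \<Rightarrow> real) \<Rightarrow> ('d::finite \<Rightarrow> 'a \<Rightarrow> real) \<Rightarrow> real^'d \<Rightarrow> real^'d" where
  "eta M p u \<theta> = (\<chi> j. expect M (exp_density M p u \<theta>) (u j))"

definition moment2 :: "'a measure \<Rightarrow> ('a \<Rightarrow> real) \<Rightarrow> ('d::finite \<Rightarrow> 'a \<Rightarrow> real) \<Rightarrow> real^'d \<Rightarrow> real^'d^'d" where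
  "moment2 M p u \<theta> = (\<chi> j k. expect M (exp_density M p u \<theta>) (\<lambda>x. u j x * u k x))"

definition fisher :: "'a measure \<Rightarrow> ('a \<Rightarrow> real) \<Rightarrow> ('d::finite \<Rightarrow> 'a \<Rightarrow> real) \<Rightarrow> real^'d \<Rightarrow> real^'d^'d" where
  "fisher M p u \<theta> = (\<chi> j k. cov M (exp_density M p u \<theta>) (u j) (u k))"


text \<open>Vectors of length \<open>d + 1\<close> are indexed by \<open>'d + unit\<close>, where \<open>Inr ()\<close> is the last index.\<close>

definition augmented :: "('d::finite \<Rightarrow> 'a \<Rightarrow> real) \<Rightarrow> 'a \<Rightarrow> real^('d + unit)" where
  "augmented u x = (\<chi> i. case i of Inl j \<Rightarrow> u j x | Inr _ \<Rightarrow> 1)"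

definition embed :: "'a measure \<Rightarrow> ('d::finite \<Rightarrow> 'a \<Rightarrow> real) \<Rightarrow> ('a \<Rightarrow> real)
    \<Rightarrow> real^('d + unit)^('d + unit)" where
  "embed M u q = (\<chi> i j. expect M q (\<lambda>x. augmented u x $ i * augmented u x $ j))"

definition embed_param :: "'a measure \<Rightarrow> ('a \<Rightarrow> real) \<Rightarrow> ('d::finite \<Rightarrow> 'a \<Rightarrow> real) \<Rightarrow> real^'d
    \<Rightarrow> real^('d + unit)^('d + unit)" where
  "embed_param M p u \<theta> = embed M u (exp_density M p u \<theta>)"

definition bordered :: "real^'d^'d \<Rightarrow> real^'d \<Rightarrow> real^('d::finite + unit)^('d + unit)" where
  "bordered A v = (\<chi> i j. case (i, j) of
       (Inl l, Inl m) \<Rightarrow> A$l$m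
     | (Inl l, Inr _) \<Rightarrow> v$l
     | (Inr _, Inl m) \<Rightarrow> v$m
     | (Inr _, Inr _) \<Rightarrow> 1)"

definition airm :: "real^'n^'n \<Rightarrow> real^'n^'n \<Rightarrow> real^'n^'n \<Rightarrow> real" where
  "airm S X Y = 1/2 * trace (matrix_inv S ** X ** matrix_inv S ** Y)"

definition partial_deriv :: "(real^'d \<Rightarrow> 'b::real_normed_vector) \<Rightarrow> real^'d \<Rightarrow> 'd \<Rightarrow> 'b" where
  "partial_deriv f \<theta> j = vector_derivative (\<lambda>t. f (\<theta> + t *\<^sub>R axis j 1)) (at 0)"

definition pullback_metric :: "'a measure \<Rightarrow> ('a \<Rightarrow> real) \<Rightarrow> ('d::finite \<Rightarrow> 'a \<Rightarrow> real) \<Rightarrow> real^'d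
    \<Rightarrow> real^'d^'d" where
  "pullback_metric M p u \<theta> = (\<chi> j k. airm (embed_param M p u \<theta>)
     (partial_deriv (embed_param M p u) \<theta> j) (partial_deriv (embed_param M p u) \<theta> k))"

definition line_element :: "'a measure \<Rightarrow> ('a \<Rightarrow> real) \<Rightarrow> ('d::finite \<Rightarrow> 'a \<Rightarrow> real) \<Rightarrow> real^'d
    \<Rightarrow> real^'d \<Rightarrow> real" where
  "line_element M p u \<theta> h =
     (\<Sum>j\<in>UNIV. \<Sum>k\<in>UNIV. pullback_metric M p u \<theta> $ j $ k * h$j * h$k)"

end

theory Submission
  imports Defs "HOL-Probability.Probability_Measure"
begin

text \<open>
  Two independent facts are combined: a differentiation formula for exponential families, and a
  block matrix computation.

  Near \<open>\<theta>\<close> the family consists of exponential tilts of the single probability measure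
  \<open>p\<^sub>\<theta> \<cdot> \<mu>\<close>: the expectation of \<open>f\<close> at \<open>\<theta> + h\<close> is
  \<open>E\<^sub>\<theta>[f exp (h \<bullet> u)] / E\<^sub>\<theta>[exp (h \<bullet> u)]\<close>. Its derivative at \<open>h = 0\<close> is the covariance
  \<open>E\<^sub>\<theta>[f (h \<bullet> u)] - E\<^sub>\<theta>[f] E\<^sub>\<theta>[h \<bullet> u]\<close> (\<open>has_derivative_tilted_mean\<close>). With \<open>f = u\<^sub>l\<close> this is
  \<open>d\<eta> = I d\<theta>\<close>, and with \<open>f = u\<^sub>l u\<^sub>m\<close> it is the formula for \<open>dA\<close>.

  The derivative exists because \<open>exp (c \<Sum>\<^sub>j \<bar>u\<^sub>j\<bar>)\<close> is integrable under \<open>p\<^sub>\<theta>\<close> for some \<open>c > 0\<close>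
  (\<open>exp_moment_abs_sum\<close>). This is what \<open>\<theta> \<in> \<Theta>\<close> provides: small linear combinations of the \<open>u\<^sub>j\<close>
  have small Orlicz norm, so all parameters near \<open>\<theta>\<close> have a finite partition function, and
  finitely many of these dominate the exponential of the sum of absolute values. Such an exponential moment
  dominates polynomials in the \<open>u\<^sub>j\<close> as well as the second-order Taylor remainder of the tilt.

  For the metric, the Schur complement of the corner of \<open>S\<close> is \<open>A - \<eta> \<eta>\<^sup>T = I\<close>. The Fisher matrix is
  invertible because the \<open>u\<^sub>j\<close> are linearly independent and centred (\<open>fisher_kernel_trivial\<close>), so
  \<open>S\<inverse>\<close> has the blocks \<open>I\<inverse>\<close>, \<open>- I\<inverse> \<eta>\<close> and \<open>\<gamma>\<close> (\<open>bordered_left_inverse\<close>). The corner of \<open>S\<close> is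
  constant, so \<open>dS\<close> has the blocks \<open>dA\<close>, \<open>d\<eta>\<close> and \<open>0\<close>. Multiplying out \<open>tr ((S\<inverse> dS)\<^sup>2)\<close> with the
  symmetry of \<open>I\<inverse>\<close> and \<open>dA\<close> gives the line element (\<open>trace_bordered_square\<close>).
\<close>

section \<open>Matrices bordered by one row and one column\<close>

text \<open>A \<open>2 \<times> 2\<close> block matrix whose last block is \<open>1 \<times> 1\<close>. The corner and the two border vectors are
  free, so that \<open>S\<close>, its inverse and its differentials all have this form.\<close>

definition block :: "real^'d^'d \<Rightarrow> real^'d \<Rightarrow> real^'d \<Rightarrow> real \<Rightarrow> real^('d::finite + unit)^('d + unit)"
  where "block A b c s = (\<chi> i j. case (i, j) of
       (Inl l, Inl m) \<Rightarrow> A$l$m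
     | (Inl l, Inr _) \<Rightarrow> b$l
     | (Inr _, Inl m) \<Rightarrow> c$m
     | (Inr _, Inr _) \<Rightarrow> s)"

definition outer :: "real^'n \<Rightarrow> real^'m \<Rightarrow> real^'m^'n"
  where "outer a b = (\<chi> i j. a$i * b$j)"

lemma block_nth [simp]:
  "block A b c s $ Inl l $ Inl m = A$l$m" "block A b c s $ Inl l $ Inr v = b$l"
  "block A b c s $ Inr w $ Inl m = c$m" "block A b c s $ Inr w $ Inr v = s"
  by (simp_all add: block_def)

lemma bordered_eq_block: "bordered A v = block A v v 1"
  by (simp add: bordered_def block_def)

lemma sum_UNIV_plus_unit:
  "(\<Sum>i\<in>(UNIV::('d::finite + unit) set). f i) = (\<Sum>j\<in>UNIV. f (Inl j)) + f (Inr ())"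
  by (subst UNIV_Plus_UNIV[symmetric], subst sum.Plus) (auto simp: UNIV_unit)

lemma mat_eq_block_iff:
  "X = block A b c s \<longleftrightarrow>
     (\<forall>l m. X $ Inl l $ Inl m = A$l$m) \<and> (\<forall>l. X $ Inl l $ Inr () = b$l) \<and>
     (\<forall>m. X $ Inr () $ Inl m = c$m) \<and> X $ Inr () $ Inr () = s"
proof
  assume R: "(\<forall>l m. X $ Inl l $ Inl m = A$l$m) \<and> (\<forall>l. X $ Inl l $ Inr () = b$l) \<and>
     (\<forall>m. X $ Inr () $ Inl m = c$m) \<and> X $ Inr () $ Inr () = s"
  have "X $ i $ j = block A b c s $ i $ j" for i j
    using R by (cases i; cases j) auto
  then show "X = block A b c s" by (simp add: vec_eq_iff)
qed simp

text \<open>Block matrices are closed under products; this reduces every computation with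
  \<open>(d + 1) \<times> (d + 1)\<close> matrices below to one with \<open>d \<times> d\<close> matrices and vectors.\<close>

lemma block_mult:
  "block A b c s ** block A' b' c' s' =
     block (A ** A' + outer b c') (A *v b' + s' *\<^sub>R b) (c v* A' + s *\<^sub>R c') (c \<bullet> b' + s * s')"
  unfolding mat_eq_block_iff
  by (auto simp: matrix_matrix_mult_def sum_UNIV_plus_unit outer_def
      matrix_vector_mult_def vector_matrix_mult_def inner_vec_def mult.commute)

lemma trace_block: "trace (block A b c s) = trace A + s"
  by (simp add: trace_def sum_UNIV_plus_unit)

lemma mat_1_eq_block: "mat 1 = block (mat 1) 0 0 1"
  unfolding mat_eq_block_iff by (auto simp: mat_def)

lemma trace_outer: "trace (outer a b) = a \<bullet> b"
  by (simp add: trace_def outer_def inner_vec_def)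

lemma mult_outer: "X ** outer a b = outer (X *v a) b"
  by (simp add: vec_eq_iff outer_def matrix_matrix_mult_def matrix_vector_mult_def
      sum_distrib_left sum_distrib_right mult_ac)

lemma outer_mult_vec: "outer a b *v x = (b \<bullet> x) *\<^sub>R a"
  by (simp add: vec_eq_iff outer_def matrix_vector_mult_def inner_vec_def
      sum_distrib_left sum_distrib_right mult_ac)

lemma vec_mult_outer: "x v* outer a b = (x \<bullet> a) *\<^sub>R b"
  by (simp add: vec_eq_iff outer_def vector_matrix_mult_def inner_vec_def
      sum_distrib_left sum_distrib_right mult_ac)

lemma matrix_diff_ldistrib:
  fixes A :: "real^'n^'m" and B C :: "real^'k^'n"
  shows "A ** (B - C) = A ** B - A ** C"
  by (simp add: vec_eq_iff matrix_matrix_mult_def algebra_simps sum_subtractf)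

lemma matrix_diff_rdistrib:
  fixes A B :: "real^'n^'m" and C :: "real^'k^'n"
  shows "(A - B) ** C = A ** C - B ** C"
  by (simp add: vec_eq_iff matrix_matrix_mult_def algebra_simps sum_subtractf)

lemma matrix_inv_eqI:
  fixes A B :: "real^'n^'n"
  assumes "B ** A = mat 1"
  shows "matrix_inv A = B" 
proof -
  have AB: "A ** B = mat 1"
    using assms by (simp add: matrix_left_right_inverse)
  have "A ** matrix_inv A = mat 1"
    unfolding matrix_inv_def by (rule someI2[where a=B]) (use assms AB in auto)
  then have "B ** (A ** matrix_inv A) = B" by simp
  then show ?thesis by (simp add: matrix_mul_assoc assms)
qed

text \<open>The scalar form of symmetry: the mixed terms of the trace computation are brought to a common
  shape by moving symmetric matrices across inner products.\<close>

lemma inner_matrix_symmetric: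
  fixes A :: "real^'n^'n"
  assumes "transpose A = A"
  shows "a \<bullet> (A *v b) = b \<bullet> (A *v a)"
  by (metis assms dot_lmul_matrix inner_commute transpose_matrix_vector)

text \<open>The Schur complement of the corner entry \<open>1\<close> of the bordered matrix is \<open>A - e e\<^sup>T\<close>, so the
  inverse of the bordered matrix is governed by the inverse \<open>J\<close> of that complement.\<close>

lemma bordered_left_inverse:
  fixes A J :: "real^'d^'d" and e :: "real^'d"
  assumes J: "J ** (A - outer e e) = mat 1" and sym: "transpose A = A" "transpose J = J"
  shows "block J (-(J *v e)) (-(J *v e)) (1 + e \<bullet> (J *v e)) ** bordered A e = mat 1"
proof -
  have JA: "J ** A = mat 1 + outer (J *v e) e"
    using J by (simp add: matrix_mul_assoc mult_outer algebra_simps matrix_diff_ldistrib)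
  have "(J *v e) v* A = A *v (J *v e)"
    by (metis sym(1) transpose_matrix_vector)
  also have "\<dots> = transpose (J ** A) *v e"
    by (simp add: matrix_transpose_mul sym matrix_vector_mul_assoc del: transpose_matrix_vector)
  also have "\<dots> = e + (e \<bullet> (J *v e)) *\<^sub>R e"
    unfolding JA transpose_matrix_vector by (simp add: vector_matrix_mult_add_rdistrib vec_mult_outer)
  finally have "(J *v e) v* A = (1 + e \<bullet> (J *v e)) *\<^sub>R e"
    by (simp add: algebra_simps)
  then show ?thesis
    unfolding bordered_eq_block block_mult mat_1_eq_block
    by (simp add: JA mat_eq_block_iff) 
       (auto simp: outer_def vec_eq_iff vector_matrix_mult_def inner_commute sum_negf)
qed

lemma transpose_matrix_inv:
  fixes A J :: "real^'d^'d"
  assumes "J ** A = mat 1" "transpose A = A" shows "transpose J = J"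
proof -
  have "transpose J = matrix_inv A"
    using assms by (metis matrix_inv_eqI matrix_left_right_inverse matrix_transpose_mul transpose_mat)
  then show ?thesis using assms(1) matrix_inv_eqI by metis
qed

text \<open>With \<open>a = J e\<close> and \<open>b = J de\<close> the product \<open>X = S\<inverse> dS\<close> has the blocks
  \<open>J dA - a de\<^sup>T\<close>, \<open>b\<close>, \<open>(\<gamma> de - dA a)\<^sup>T\<close> and \<open>- e\<^sup>T b\<close>. In \<open>tr (X\<^sup>2)\<close> the term \<open>a\<^sup>T dA b\<close>
  appears four times, twice from the square of the first block and twice from the product of the
  borders; the term \<open>(e\<^sup>T b)\<^sup>2\<close> appears twice, once from each diagonal block.\<close>

lemma trace_bordered_square:
  fixes J dA :: "real^'d^'d" and e de :: "real^'d"
  assumes "transpose J = J" "transpose dA = dA"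
  defines "\<gamma> \<equiv> 1 + e \<bullet> (J *v e)"
  defines "X \<equiv> block J (-(J *v e)) (-(J *v e)) \<gamma> ** block dA de de 0"
  shows "trace (X ** X) =
    trace (J ** dA ** J ** dA) - 4 * (e \<bullet> ((J ** dA ** J) *v de))
      + 2 * (e \<bullet> (J *v de))\<^sup>2 + 2 * (\<gamma> * (de \<bullet> (J *v de)))"
proof -
  define a where "a = J *v e"
  define b where "b = J *v de"
  have X: "X = block (J ** dA - outer a de) b (\<gamma> *\<^sub>R de - a v* dA) (- (e \<bullet> b))"
    unfolding X_def block_mult a_def[symmetric] b_def[symmetric]
    using inner_matrix_symmetric[OF assms(1), of e de]
    by (simp add: mat_eq_block_iff)
       (auto simp: outer_def vec_eq_iff vector_matrix_mult_def sum_negf a_def b_def inner_commute)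
  have e1: "a v* dA = dA *v a" by (metis assms(2) transpose_matrix_vector)
  have k1: "e \<bullet> ((J ** dA ** J) *v de) = a \<bullet> (dA *v b)"
    using inner_matrix_symmetric[OF assms(1), of e "dA *v b"]
    by (simp add: matrix_vector_mul_assoc[symmetric] a_def b_def inner_commute)
  have k2: "(J *v (dA *v a)) \<bullet> de = a \<bullet> (dA *v b)"
    using inner_matrix_symmetric[OF assms(1), of de "dA *v a"]
      inner_matrix_symmetric[OF assms(2), of a b]
    by (simp add: b_def inner_commute)
  have k3: "a \<bullet> de = e \<bullet> b"
    using inner_matrix_symmetric[OF assms(1), of e de] by (simp add: a_def b_def inner_commute)
  have t: "trace ((J ** dA - outer a de) ** (J ** dA - outer a de))
      = trace (J ** dA ** J ** dA) - 2 * (a \<bullet> (dA *v b)) + (e \<bullet> b)\<^sup>2"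
  proof -
    have "(J ** dA - outer a de) ** (J ** dA - outer a de) =
        J ** dA ** J ** dA - (J ** dA) ** outer a de - outer a de ** (J ** dA) + outer a de ** outer a de"
      by (simp add: matrix_mul_assoc matrix_diff_ldistrib matrix_diff_rdistrib)
    then have "trace ((J ** dA - outer a de) ** (J ** dA - outer a de)) =
      trace (J ** dA ** J ** dA) - 2 * trace ((J ** dA) ** outer a de) + trace (outer a de ** outer a de)"
      by (simp add: trace_add trace_sub trace_mul_sym[of "outer a de" "J ** dA"])
    moreover have "trace ((J ** dA) ** outer a de) = a \<bullet> (dA *v b)"
      by (simp add: mult_outer trace_outer matrix_vector_mul_assoc[symmetric] k2)
    moreover have "trace (outer a de ** outer a de) = (e \<bullet> b)\<^sup>2"
      by (simp add: mult_outer trace_outer outer_mult_vec k3 inner_commute[of de a] power2_eq_square)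
    ultimately show ?thesis by simp
  qed
  have "trace (X ** X) = trace ((J ** dA - outer a de) ** (J ** dA - outer a de))
      + 2 * (b \<bullet> (\<gamma> *\<^sub>R de - a v* dA)) + (e \<bullet> b)\<^sup>2"
    unfolding X block_mult trace_block
    by (simp add: trace_add trace_outer inner_commute power2_eq_square)
  also have "\<dots> = trace (J ** dA ** J ** dA) - 4 * (a \<bullet> (dA *v b))
      + 2 * (e \<bullet> b)\<^sup>2 + 2 * (\<gamma> * (de \<bullet> b))"
    using inner_matrix_symmetric[OF assms(2), of a b]
    by (simp add: t e1 inner_diff_right inner_commute algebra_simps)
  finally show ?thesis by (simp add: k1 b_def)
qed

text \<open>Bilinearity of the metric: the line element evaluates the metric on the single tangent matrix
  \<open>\<Sum>\<^sub>j h\<^sub>j X\<^sub>j\<close>.\<close>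

lemma airm_sum:
  fixes X :: "'d::finite \<Rightarrow> real^'n^'n" and h :: "real^'d"
  shows "(\<Sum>j\<in>UNIV. \<Sum>k\<in>UNIV. airm S (X j) (X k) * h$j * h$k)
    = airm S (\<Sum>j\<in>UNIV. h$j *\<^sub>R X j) (\<Sum>j\<in>UNIV. h$j *\<^sub>R X j)"
proof -
  let ?t = "\<lambda>Y Z. trace (matrix_inv S ** Y ** matrix_inv S ** Z)"
  have l2: "linear (?t Y)" for Y
  proof (rule linearI)
    show "?t Y (r *\<^sub>R Z) = r *\<^sub>R ?t Y Z" for r Z
      unfolding trace_def matrix_matrix_mult_def[of "matrix_inv S ** Y ** matrix_inv S"]
      by (simp add: sum_distrib_left mult_ac)
  qed (simp add: matrix_add_ldistrib trace_add)
  have swap: "?t Y Z = ?t Z Y" for Y Z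
    using trace_mul_sym[of "matrix_inv S ** Y" "matrix_inv S ** Z"] by (simp add: matrix_mul_assoc)
  have l1: "linear (\<lambda>Y. ?t Y Z)" for Z
    by (subst swap) (rule l2)
  have "?t (\<Sum>j\<in>UNIV. h$j *\<^sub>R X j) (\<Sum>k\<in>UNIV. h$k *\<^sub>R X k)
      = (\<Sum>j\<in>UNIV. \<Sum>k\<in>UNIV. h$j * (h$k * ?t (X j) (X k)))"
    by (simp add: linear_sum[OF l1] linear_scale[OF l1] linear_sum[OF l2] linear_scale[OF l2]
        sum_distrib_left)
       (subst sum.swap, simp add: mult.left_commute)
  then show ?thesis
    unfolding airm_def by (simp add: sum_distrib_left mult_ac)
qed

section \<open>Differentiation of exponentially tilted means\<close>

text \<open>This function dominates all the \<open>u\<^sub>j\<close> at once and, by a factor of the norm of the parameter, every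
  linear combination of them. Integrability of \<open>exp (c * abs_sum u)\<close> for one \<open>c > 0\<close> is the form
  in which membership in the interior of the domain of the cumulant functional is used.\<close>

definition abs_sum :: "('d::finite \<Rightarrow> 'a \<Rightarrow> real) \<Rightarrow> 'a \<Rightarrow> real"
  where "abs_sum u x = (\<Sum>j\<in>UNIV. \<bar>u j x\<bar>)"

lemma abs_sum_nonneg: "0 \<le> abs_sum u x"
  by (simp add: abs_sum_def sum_nonneg)

lemma component_le_abs_sum: "\<bar>u j x\<bar> \<le> abs_sum u x"
  unfolding abs_sum_def by (rule member_le_sum) auto

lemma abs_lincomb_le: "\<bar>lincomb u h x\<bar> \<le> norm h * abs_sum u x"
proof -
  have "\<bar>lincomb u h x\<bar> \<le> (\<Sum>j\<in>UNIV. \<bar>h$j * u j x\<bar>)"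
    unfolding lincomb_def by (rule sum_abs)
  also have "\<dots> \<le> (\<Sum>j\<in>UNIV. norm h * \<bar>u j x\<bar>)"
    by (intro sum_mono) (simp add: abs_mult component_le_norm_cart mult_right_mono)
  finally show ?thesis by (simp add: abs_sum_def sum_distrib_left)
qed

lemma lincomb_add: "lincomb u (g + h) x = lincomb u g x + lincomb u h x"
  by (simp add: lincomb_def algebra_simps sum.distrib)

lemma lincomb_scaleR: "lincomb u (r *\<^sub>R h) x = r * lincomb u h x"
  by (simp add: lincomb_def algebra_simps sum_distrib_left)

lemma lincomb_axis: "lincomb u (axis j r) x = r * u j x"
proof -
  have "lincomb u (axis j r) x = (\<Sum>k\<in>UNIV. if k = j then r * u k x else 0)"
    unfolding lincomb_def by (intro sum.cong) (auto simp: axis_def)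
  then show ?thesis by simp
qed

lemma lincomb_zero [simp]: "lincomb u 0 x = 0"
  by (simp add: lincomb_def)

lemma borel_measurable_lincomb [measurable]:
  "(\<And>j. u j \<in> borel_measurable M) \<Longrightarrow> lincomb u h \<in> borel_measurable M"
  unfolding lincomb_def[abs_def] by measurable

lemma borel_measurable_abs_sum [measurable]:
  "(\<And>j. u j \<in> borel_measurable M) \<Longrightarrow> abs_sum u \<in> borel_measurable M"
  unfolding abs_sum_def[abs_def] by measurable

lemma power_le_exp:
  fixes x t :: real
  assumes "0 \<le> x" "0 < t"
  shows "x ^ n \<le> fact n / t ^ n * exp (t * x)"
proof -
  have "(\<Sum>k\<in>{n}. (t * x) ^ k /\<^sub>R fact k) \<le> (\<Sum>k. (t * x) ^ k /\<^sub>R fact k)"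
    using assms by (intro sum_le_suminf summable_exp_generic) auto
  then have "(t * x) ^ n / fact n \<le> exp (t * x)"
    by (simp add: exp_def divide_inverse mult.commute)
  then show ?thesis using assms by (simp add: power_mult_distrib field_simps)
qed

lemma exp_taylor2_bound:
  fixes y :: real shows "\<bar>exp y - 1 - y\<bar> \<le> y\<^sup>2 * exp \<bar>y\<bar>"
proof -
  obtain t where t: "\<bar>t\<bar> \<le> \<bar>y\<bar>" "exp y = (\<Sum>m<2. y ^ m / fact m) + exp t / fact 2 * y ^ 2"
    using Maclaurin_exp_le[of y 2] by blast
  then have "exp y - 1 - y = exp t / 2 * y\<^sup>2" by (simp add: numeral_2_eq_2)
  moreover have "exp t / 2 \<le> exp \<bar>y\<bar>"
    using t(1) by (smt (verit) exp_gt_zero exp_le_cancel_iff field_sum_of_halves)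
  ultimately show ?thesis
    using mult_right_mono[of "exp t / 2" "exp \<bar>y\<bar>" "y\<^sup>2"]
    by (simp only: abs_mult mult.commute[of "y\<^sup>2"]) simp
qed

text \<open>Half of the exponent absorbs the polynomial growth of \<open>f\<close>; the other half is kept, because
  differentiation needs an exponential weight again.\<close>

lemma integrable_growth:
  assumes [measurable]: "\<And>j. u j \<in> borel_measurable P" "f \<in> borel_measurable P"
    and "0 < c" and int: "integrable P (\<lambda>x. exp (c * abs_sum u x))"
    and f: "\<And>x. \<bar>f x\<bar> \<le> abs_sum u x ^ n"
  shows "integrable P (\<lambda>x. f x * exp (c/2 * abs_sum u x))"
proof (rule Bochner_Integration.integrable_bound)
  show "integrable P (\<lambda>x. fact n / (c/2) ^ n * exp (c * abs_sum u x))" using int by simp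
  show "AE x in P. norm (f x * exp (c/2 * abs_sum u x)) \<le> norm (fact n / (c/2) ^ n * exp (c * abs_sum u x))"
  proof (rule AE_I2)
    fix x
    have "\<bar>f x\<bar> \<le> fact n / (c/2) ^ n * exp (c/2 * abs_sum u x)"
      using f[of x] power_le_exp[OF abs_sum_nonneg[of u x], of "c/2" n] \<open>0 < c\<close> by simp
    then have "\<bar>f x\<bar> * exp (c/2 * abs_sum u x)
        \<le> fact n / (c/2) ^ n * exp (c/2 * abs_sum u x) * exp (c/2 * abs_sum u x)"
      by (intro mult_right_mono) auto
    also have "\<dots> = fact n / (c/2) ^ n * exp (c * abs_sum u x)"
      by (simp add: mult_exp_exp field_simps)
    finally show "norm (f x * exp (c/2 * abs_sum u x)) \<le> norm (fact n / (c/2) ^ n * exp (c * abs_sum u x))"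
      using \<open>0 < c\<close> by (simp add: abs_mult)
  qed
qed measurable

text \<open>The bound \<open>\<bar>exp y - 1 - y\<bar> \<le> y\<^sup>2 exp \<bar>y\<bar>\<close> with \<open>y\<close> the linear combination of the \<open>u\<^sub>j\<close> leaves,
  after integration, a remainder of order \<open>(norm h)\<^sup>2\<close>. Differentiation under the integral sign thus
  follows from a direct estimate, and total differentiability comes without partial derivatives.\<close>

lemma has_derivative_exp_integral:
  fixes u :: "'d::finite \<Rightarrow> 'a \<Rightarrow> real"
  assumes [measurable]: "\<And>j. u j \<in> borel_measurable P" "f \<in> borel_measurable P"
    and c: "0 < c" and int: "integrable P (\<lambda>x. f x * exp (c * abs_sum u x))"
  shows "((\<lambda>h. \<integral>x. f x * exp (lincomb u h x) \<partial>P) has_derivative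
           (\<lambda>h. \<integral>x. f x * lincomb u h x \<partial>P)) (at 0)"
proof -
  let ?U = "abs_sum u"
  have bound: "integrable P g"
    if [measurable]: "g \<in> borel_measurable P"
      and "\<And>x. \<bar>g x\<bar> \<le> K * (\<bar>f x\<bar> * exp (c * ?U x))" for g K
  proof (rule Bochner_Integration.integrable_bound)
    show "integrable P (\<lambda>x. K * (\<bar>f x\<bar> * exp (c * ?U x)))"
      using int[THEN integrable_norm] by (simp add: abs_mult)
    show "AE x in P. norm (g x) \<le> norm (K * (\<bar>f x\<bar> * exp (c * ?U x)))"
      by (rule AE_I2, rule order_trans[OF that(2)[folded real_norm_def]]) simp
  qed fact
  have U_exp: "?U x \<le> 1 / c * exp (c * ?U x)" for x
    using power_le_exp[OF abs_sum_nonneg[of u x] c, of 1] by simp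
  have int0: "integrable P f"
    by (rule bound[where K=1]) (use c abs_sum_nonneg[of u] in \<open>auto simp: mult_le_cancel_left1\<close>)
  have int1: "integrable P (\<lambda>x. f x * lincomb u h x)" for h
  proof (rule bound[where K="norm h / c"])
    fix x
    have "\<bar>lincomb u h x\<bar> \<le> norm h * (1 / c * exp (c * ?U x))"
      using abs_lincomb_le[of u h x] mult_left_mono[OF U_exp[of x] norm_ge_zero[of h]] by linarith
    then show "\<bar>f x * lincomb u h x\<bar> \<le> norm h / c * (\<bar>f x\<bar> * exp (c * ?U x))"
      using mult_left_mono[of "\<bar>lincomb u h x\<bar>" _ "\<bar>f x\<bar>"] by (fastforce simp: abs_mult mult_ac)
  qed simp
  have int2: "integrable P (\<lambda>x. f x * exp (lincomb u h x))" if "norm h \<le> c" for h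
  proof (rule bound[where K=1])
    fix x
    have "lincomb u h x \<le> c * ?U x"
      using abs_lincomb_le[of u h x] mult_right_mono[OF that abs_sum_nonneg[of u x]] by linarith
    then show "\<bar>f x * exp (lincomb u h x)\<bar> \<le> 1 * (\<bar>f x\<bar> * exp (c * ?U x))"
      by (simp add: abs_mult mult_left_mono)
  qed simp
  \<comment> \<open>The constant 8 is \<open>2! / (1/2)\<^sup>2\<close>: half of the weight \<open>exp (c * ?U x)\<close> bounds \<open>(?U x)\<^sup>2\<close>, and the
      other half bounds \<open>exp \<bar>lincomb u h x\<bar>\<close>.\<close>
  define C where "C = 8 / c\<^sup>2 * (\<integral>x. \<bar>f x\<bar> * exp (c * ?U x) \<partial>P)"
  have remainder: "norm ((\<integral>x. f x * exp (lincomb u h x) \<partial>P) - (\<integral>x. f x * exp (lincomb u 0 x) \<partial>P)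
      - (\<integral>x. f x * lincomb u h x \<partial>P)) / norm h \<le> C * norm h" if h: "norm h \<le> c/2" for h
  proof -
    have "(\<integral>x. f x * exp (lincomb u h x) \<partial>P) - (\<integral>x. f x * exp (lincomb u 0 x) \<partial>P)
      - (\<integral>x. f x * lincomb u h x \<partial>P) = (\<integral>x. f x * (exp (lincomb u h x) - 1 - lincomb u h x) \<partial>P)"
      using int0 int1[of h] int2[of h] h c by (simp add: right_diff_distrib)
    also have "norm \<dots> \<le> (\<integral>x. 8 / c\<^sup>2 * (norm h)\<^sup>2 * (\<bar>f x\<bar> * exp (c * ?U x)) \<partial>P)"
    proof (rule order_trans[OF integral_norm_bound integral_mono])
      show "integrable P (\<lambda>x. norm (f x * (exp (lincomb u h x) - 1 - lincomb u h x)))"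
        using int0 int1[of h] int2[of h] h c by (intro integrable_norm) (simp add: right_diff_distrib)
      show "integrable P (\<lambda>x. 8 / c\<^sup>2 * (norm h)\<^sup>2 * (\<bar>f x\<bar> * exp (c * ?U x)))"
        using int[THEN integrable_norm] by (simp add: abs_mult)
      fix x
      let ?y = "lincomb u h x"
      have y: "\<bar>?y\<bar> \<le> norm h * ?U x" by (rule abs_lincomb_le)
      have y': "\<bar>?y\<bar> \<le> c/2 * ?U x"
        using y mult_right_mono[OF h abs_sum_nonneg[of u x]] by linarith
      have "?y\<^sup>2 \<le> (norm h)\<^sup>2 * (?U x)\<^sup>2"
        using power_mono[OF y, of 2] by (simp add: power_mult_distrib)
      also have "\<dots> \<le> (norm h)\<^sup>2 * (8 / c\<^sup>2 * exp (c/2 * ?U x))"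
        using power_le_exp[OF abs_sum_nonneg[of u x], of "c/2" 2] c
        by (intro mult_left_mono) (auto simp: power_divide)
      finally have "?y\<^sup>2 * exp \<bar>?y\<bar> \<le> (norm h)\<^sup>2 * (8 / c\<^sup>2 * exp (c/2 * ?U x)) * exp (c/2 * ?U x)"
        using y' by (intro mult_mono) auto
      also have "\<dots> = 8 / c\<^sup>2 * (norm h)\<^sup>2 * exp (c * ?U x)"
        by (simp add: mult_exp_exp field_simps)
      finally have "\<bar>exp ?y - 1 - ?y\<bar> \<le> 8 / c\<^sup>2 * (norm h)\<^sup>2 * exp (c * ?U x)"
        using exp_taylor2_bound[of ?y] by linarith
      from mult_left_mono[OF this abs_ge_zero[of "f x"]]
      show "norm (f x * (exp ?y - 1 - ?y)) \<le> 8 / c\<^sup>2 * (norm h)\<^sup>2 * (\<bar>f x\<bar> * exp (c * ?U x))"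
        by (simp add: abs_mult mult_ac)
    qed
    also have "\<dots> = C * norm h * norm h" by (simp add: C_def power2_eq_square)
    finally show ?thesis by (cases "h = 0") (simp_all add: divide_le_eq)
  qed
  show ?thesis
  proof (rule has_derivativeI_sandwich[where e="c/2" and H="\<lambda>h. C * norm h"])
    show "bounded_linear (\<lambda>h. \<integral>x. f x * lincomb u h x \<partial>P)"
    proof (intro linear_conv_bounded_linear[THEN iffD1] linearI)
      show "(\<integral>x. f x * lincomb u (g + h) x \<partial>P) =
          (\<integral>x. f x * lincomb u g x \<partial>P) + (\<integral>x. f x * lincomb u h x \<partial>P)" for g h
        using int1 by (simp add: lincomb_add distrib_left)
      show "(\<integral>x. f x * lincomb u (r *\<^sub>R h) x \<partial>P) = r *\<^sub>R (\<integral>x. f x * lincomb u h x \<partial>P)" for r h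
        by (simp add: lincomb_scaleR mult.left_commute)
    qed
    show "((\<lambda>h. C * norm h) \<longlongrightarrow> 0) (at 0)" by (auto intro!: tendsto_eq_intros)
    show "0 < c/2" using c by simp
  qed (use remainder in \<open>auto simp: dist_norm\<close>)
qed

text \<open>Quotient rule at a probability measure, where the denominator is \<open>1\<close>: the derivative of the
  exponentially tilted mean of \<open>f\<close> is the covariance of \<open>f\<close> with the direction of tilting. Both
  differentials in the theorem are instances of this.\<close>

lemma has_derivative_tilted_mean:
  fixes u :: "'d::finite \<Rightarrow> 'a \<Rightarrow> real"
  assumes "prob_space P"
    and [measurable]: "\<And>j. u j \<in> borel_measurable P" "f \<in> borel_measurable P"
    and c: "0 < c" "integrable P (\<lambda>x. exp (c * abs_sum u x))"
      "integrable P (\<lambda>x. f x * exp (c * abs_sum u x))"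
  shows "((\<lambda>h. (\<integral>x. f x * exp (lincomb u h x) \<partial>P) / (\<integral>x. exp (lincomb u h x) \<partial>P)) has_derivative
           (\<lambda>h. (\<integral>x. f x * lincomb u h x \<partial>P) - (\<integral>x. f x \<partial>P) * (\<integral>x. lincomb u h x \<partial>P))) (at 0)"
proof -
  interpret prob_space P by fact
  note F = has_derivative_exp_integral[OF assms(2,3) c(1,3)]
  have G: "((\<lambda>h. \<integral>x. exp (lincomb u h x) \<partial>P) has_derivative (\<lambda>h. \<integral>x. lincomb u h x \<partial>P)) (at 0)"
    using has_derivative_exp_integral[of u P "\<lambda>_. 1" c] c by simp
  show ?thesis
    by (rule has_derivative_eq_rhs[OF has_derivative_divide'[OF F G]]) (simp_all add: prob_space)
qed

section \<open>Linear combinations in the Orlicz space and exponential moments\<close>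

text \<open>This consequence of convexity turns small coefficients into small values of
  \<open>\<integral> (cosh v - 1)\<close>, hence into small Orlicz norms.\<close>

lemma cosh_scale_le:
  fixes s t :: real
  assumes "0 \<le> s" "s \<le> 1"
  shows "cosh (s * t) - 1 \<le> s * (cosh t - 1)"
proof -
  have "exp (s * y) \<le> s * exp y + (1 - s)" for y :: real
    using convex_onD[OF exp_convex, of s 0 y] assms by simp
  from this[of t] this[of "-t"] show ?thesis
    by (simp add: cosh_def field_simps)
qed

text \<open>Bounding the sum by its largest term separates the variables: a nonnegative increasing function of \<open>abs_sum u x\<close> is
  bounded by a sum over \<open>k\<close> of functions of a single \<open>u k x\<close>.\<close>

lemma abs_sum_le_card_mult:
  fixes u :: "'d::finite \<Rightarrow> 'a \<Rightarrow> real"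
  obtains k where "abs_sum u x \<le> real CARD('d) * \<bar>u k x\<bar>"
proof -
  have "Max (range (\<lambda>j. \<bar>u j x\<bar>)) \<in> range (\<lambda>j. \<bar>u j x\<bar>)" by (rule Max_in) auto
  then obtain k where k: "Max (range (\<lambda>j. \<bar>u j x\<bar>)) = \<bar>u k x\<bar>" by (rule rangeE)
  have "\<bar>u j x\<bar> \<le> \<bar>u k x\<bar>" for j
    unfolding k[symmetric] by (rule Max_ge) auto
  then have "abs_sum u x \<le> real CARD('d) * \<bar>u k x\<bar>"
    unfolding abs_sum_def by (intro sum_bounded_above) auto
  then show ?thesis by (rule that)
qed

lemma densitiesD:
  assumes "p \<in> densities M"
  shows "p \<in> borel_measurable M" "AE x in M. 0 < p x" "AE x in M. 0 \<le> p x" "integrable M p"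
    "(\<integral>x. p x \<partial>M) = 1"
  using assms by (auto simp: densities_def elim: eventually_mono)

lemma prob_space_density_densities:
  assumes "p \<in> densities M" shows "prob_space (density M p)"
proof (rule prob_spaceI)
  note [measurable] = densitiesD(1)[OF assms]
  have "emeasure (density M p) (space (density M p)) = (\<integral>\<^sup>+x. ennreal (p x) \<partial>M)"
    by (auto simp: emeasure_density intro!: nn_integral_cong)
  also have "\<dots> = 1"
    using densitiesD[OF assms] by (simp add: nn_integral_eq_integral)
  finally show "emeasure (density M p) (space (density M p)) = 1" .
qed

lemma expect_eq_integral_density:
  assumes "p \<in> densities M" "f \<in> borel_measurable M"
  shows "expect M p f = (\<integral>x. f x \<partial>density M p)"
  using assms by (simp add: expect_def integral_density densitiesD mult.commute)

lemma nn_expect_eq_nn_integral_density: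
  assumes "p \<in> densities M" and [measurable]: "f \<in> borel_measurable M"
  shows "nn_expect M p f = (\<integral>\<^sup>+x. ennreal (f x) \<partial>density M p)"
proof -
  note [measurable] = densitiesD(1)[OF assms(1)]
  have "(\<integral>\<^sup>+x. ennreal (f x) \<partial>density M p) = (\<integral>\<^sup>+x. ennreal (p x) * ennreal (f x) \<partial>M)"
    by (simp add: nn_integral_density)
  also have "\<dots> = nn_expect M p f"
    unfolding nn_expect_def using densitiesD(3)[OF assms(1)]
    by (intro nn_integral_cong_AE) (auto simp: ennreal_mult'' mult.commute elim: eventually_mono)
  finally show ?thesis ..
qed

lemma orlicz_space_integrable_cosh:
  assumes p: "p \<in> densities M" and v: "v \<in> orlicz_space M p"
  shows "\<exists>\<alpha>>0. integrable (density M p) (\<lambda>x. cosh (\<alpha> * v x))"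
proof -
  interpret prob_space "density M p" by (rule prob_space_density_densities[OF p])
  have [measurable]: "v \<in> borel_measurable M" using v by (simp add: orlicz_space_def)
  obtain \<alpha> where \<alpha>: "\<alpha> > 0" "nn_expect M p (\<lambda>x. cosh (\<alpha> * v x) - 1) < \<infinity>"
    using v by (auto simp: orlicz_space_def)
  have "integrable (density M p) (\<lambda>x. cosh (\<alpha> * v x) - 1)"
  proof (rule integrableI_nonneg)
    show "(\<integral>\<^sup>+x. ennreal (cosh (\<alpha> * v x) - 1) \<partial>density M p) < \<infinity>"
      using \<alpha>(2) by (subst (asm) nn_expect_eq_nn_integral_density[OF p]) (auto simp: cosh_def)
  next
    show "(\<lambda>x. cosh (\<alpha> * v x) - 1) \<in> borel_measurable (density M p)" by (simp add: cosh_def)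
  qed (simp add: cosh_real_ge_1)
  then have "integrable (density M p) (\<lambda>x. (cosh (\<alpha> * v x) - 1) + 1)"
    by (rule Bochner_Integration.integrable_add) simp
  then show ?thesis using \<alpha>(1) by auto
qed

lemma orlicz_space_common_cosh:
  fixes u :: "'d::finite \<Rightarrow> 'a \<Rightarrow> real"
  assumes p: "p \<in> densities M" and u: "\<And>j. u j \<in> orlicz_space M p"
  shows "\<exists>\<alpha>>0. \<forall>j. integrable (density M p) (\<lambda>x. cosh (\<alpha> * u j x))"
proof -
  have [measurable]: "u j \<in> borel_measurable M" for j using u by (simp add: orlicz_space_def)
  obtain a where a: "\<And>j. a j > 0" "\<And>j. integrable (density M p) (\<lambda>x. cosh (a j * u j x))"
    using orlicz_space_integrable_cosh[OF p u] by metis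
  define \<alpha> where "\<alpha> = Min (range a)"
  have "\<alpha> > 0" using a(1) by (simp add: \<alpha>_def)
  have le: "\<alpha> \<le> a j" for j by (simp add: \<alpha>_def)
  have "integrable (density M p) (\<lambda>x. cosh (\<alpha> * u j x))" for j
  proof (rule Bochner_Integration.integrable_bound[OF a(2)[of j]])
    have "cosh \<bar>\<alpha> * u j x\<bar> \<le> cosh \<bar>a j * u j x\<bar>" for x
      using \<open>\<alpha> > 0\<close> le[of j]
      by (subst cosh_real_nonneg_le_iff) (auto simp: abs_mult intro!: mult_right_mono)
    then show "AE x in density M p. norm (cosh (\<alpha> * u j x)) \<le> norm (cosh (a j * u j x))"
      by simp
  qed (auto simp: cosh_def)
  then show ?thesis using \<open>\<alpha> > 0\<close> by auto
qed

lemma integrable_orlicz_space: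
  assumes p: "p \<in> densities M" and v: "v \<in> orlicz_space M p"
  shows "integrable (density M p) v"
proof -
  obtain \<alpha> where \<alpha>: "\<alpha> > 0" "integrable (density M p) (\<lambda>x. cosh (\<alpha> * v x))"
    using orlicz_space_integrable_cosh[OF assms] by blast
  have [measurable]: "v \<in> borel_measurable M" using v by (simp add: orlicz_space_def)
  show ?thesis
  proof (rule Bochner_Integration.integrable_bound)
    show "integrable (density M p) (\<lambda>x. 2 / \<alpha> * cosh (\<alpha> * v x))" using \<alpha>(2) by simp
    have "\<bar>v x\<bar> \<le> 2 / \<alpha> * cosh (\<alpha> * v x)" for x
    proof -
      have "\<bar>v x\<bar> \<le> 1 / \<alpha> * exp (\<alpha> * \<bar>v x\<bar>)"
        using power_le_exp[of "\<bar>v x\<bar>" \<alpha> 1] \<alpha>(1) by simp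
      also have "\<dots> \<le> 1 / \<alpha> * (2 * cosh (\<alpha> * v x))"
        using \<alpha>(1) by (intro mult_left_mono) (auto simp: cosh_def abs_if)
      finally show ?thesis by simp
    qed
    then show "AE x in density M p. norm (v x) \<le> norm (2 / \<alpha> * cosh (\<alpha> * v x))"
      using \<alpha>(1) by simp
  qed simp
qed

text \<open>The basic estimate behind all topological facts about linear combinations. The constants \<open>C\<close> and
  \<open>\<kappa>\<close> are uniform in \<open>h\<close> and \<open>r\<close>: a fixed \<open>h\<close> with large \<open>r\<close> gives membership in the Orlicz space,
  and a fixed \<open>r\<close> with small \<open>h\<close> gives smallness of the norm.\<close>

lemma nn_expect_cosh_lincomb:
  fixes u :: "'d::finite \<Rightarrow> 'a \<Rightarrow> real"
  assumes p: "p \<in> densities M" and u: "\<And>j. u j \<in> orlicz_space M p"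
  shows "\<exists>C \<kappa>. 0 \<le> C \<and> 0 < \<kappa> \<and> (\<forall>h r. 0 < r \<longrightarrow> \<kappa> * norm h \<le> r \<longrightarrow>
    nn_expect M p (\<lambda>x. cosh (lincomb u h x / r) - 1) \<le> ennreal (C * (\<kappa> * norm h / r)))"
proof -
  have [measurable]: "u j \<in> borel_measurable M" for j using u by (simp add: orlicz_space_def)
  let ?d = "real CARD('d)"
  obtain \<alpha> where \<alpha>: "\<alpha> > 0" "\<And>j. integrable (density M p) (\<lambda>x. cosh (\<alpha> * u j x))"
    using orlicz_space_common_cosh[where u=u, OF p u] by auto
  define C where "C = (\<integral>x. (\<Sum>j\<in>UNIV. cosh (\<alpha> * u j x)) \<partial>density M p)"
  have "0 \<le> C" unfolding C_def by (intro integral_nonneg_AE AE_I2 sum_nonneg) simp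
  moreover have "nn_expect M p (\<lambda>x. cosh (lincomb u h x / r) - 1) \<le> ennreal (C * (?d / \<alpha> * norm h / r))"
    if r: "0 < r" "?d / \<alpha> * norm h \<le> r" for h r
  proof -
    define s where "s = ?d / \<alpha> * norm h / r"
    have s: "0 \<le> s" "s \<le> 1" using r \<alpha>(1) by (simp_all add: s_def field_simps)
    have pt: "cosh (lincomb u h x / r) - 1 \<le> s * (\<Sum>j\<in>UNIV. cosh (\<alpha> * u j x))" for x
    proof -
      obtain k where k: "abs_sum u x \<le> ?d * \<bar>u k x\<bar>" by (rule abs_sum_le_card_mult)
      have "\<bar>lincomb u h x\<bar> \<le> norm h * (?d * \<bar>u k x\<bar>)"
        using abs_lincomb_le[of u h x] mult_left_mono[OF k norm_ge_zero[of h]] by linarith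
      then have "\<bar>lincomb u h x / r\<bar> \<le> norm h * (?d * \<bar>u k x\<bar>) / r"
        using r(1) by (simp add: divide_right_mono)
      also have "\<dots> = \<bar>s * (\<alpha> * u k x)\<bar>"
        using r(1) \<alpha>(1) by (simp add: s_def abs_mult)
      finally have "cosh \<bar>lincomb u h x / r\<bar> \<le> cosh \<bar>s * (\<alpha> * u k x)\<bar>"
        by (subst cosh_real_nonneg_le_iff) auto
      then have "cosh (lincomb u h x / r) - 1 \<le> cosh (s * (\<alpha> * u k x)) - 1"
        by (simp only: cosh_real_abs diff_right_mono)
      also have "\<dots> \<le> s * (cosh (\<alpha> * u k x) - 1)" by (rule cosh_scale_le[OF s])
      also have "\<dots> \<le> s * cosh (\<alpha> * u k x)" using s by (intro mult_left_mono) auto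
      also have "\<dots> \<le> s * (\<Sum>j\<in>UNIV. cosh (\<alpha> * u j x))"
        using s by (intro mult_left_mono member_le_sum) auto
      finally show ?thesis .
    qed
    have "nn_expect M p (\<lambda>x. cosh (lincomb u h x / r) - 1)
        = (\<integral>\<^sup>+x. ennreal (cosh (lincomb u h x / r) - 1) \<partial>density M p)"
      by (rule nn_expect_eq_nn_integral_density[OF p]) (simp add: cosh_def)
    also have "\<dots> \<le> (\<integral>\<^sup>+x. ennreal (s * (\<Sum>j\<in>UNIV. cosh (\<alpha> * u j x))) \<partial>density M p)"
      by (intro nn_integral_mono ennreal_leI pt)
    also have "\<dots> = ennreal (\<integral>x. s * (\<Sum>j\<in>UNIV. cosh (\<alpha> * u j x)) \<partial>density M p)"
      using \<alpha>(2) s by (intro nn_integral_eq_integral) (auto intro!: sum_nonneg mult_nonneg_nonneg)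
    finally show ?thesis by (simp add: C_def s_def mult.commute)
  qed
  moreover have "0 < ?d / \<alpha>" using \<alpha>(1) by simp
  ultimately show ?thesis by blast
qed

lemma expect_lincomb_eq_0:
  fixes u :: "'d::finite \<Rightarrow> 'a \<Rightarrow> real"
  assumes p: "p \<in> densities M" and u: "\<And>j. u j \<in> orlicz_space M p"
  shows "expect M p (lincomb u h) = 0"
proof -
  have [measurable]: "u j \<in> borel_measurable M" for j using u by (simp add: orlicz_space_def)
  have "expect M p (lincomb u h) = (\<Sum>j\<in>UNIV. h$j * (\<integral>x. u j x \<partial>density M p))"
    using integrable_orlicz_space[OF p u] by (simp add: expect_eq_integral_density[OF p] lincomb_def)
  also have "\<dots> = 0"
    using u by (simp add: expect_eq_integral_density[OF p, symmetric] orlicz_space_def)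
  finally show ?thesis .
qed

lemma lincomb_in_orlicz_space:
  fixes u :: "'d::finite \<Rightarrow> 'a \<Rightarrow> real"
  assumes p: "p \<in> densities M" and u: "\<And>j. u j \<in> orlicz_space M p"
  shows "lincomb u h \<in> orlicz_space M p"
proof -
  have [measurable]: "u j \<in> borel_measurable M" for j using u by (simp add: orlicz_space_def)
  obtain C \<kappa> where C: "0 \<le> C" "0 < \<kappa>" "\<forall>h r. 0 < r \<longrightarrow> \<kappa> * norm h \<le> r \<longrightarrow>
    nn_expect M p (\<lambda>x. cosh (lincomb u h x / r) - 1) \<le> ennreal (C * (\<kappa> * norm h / r))"
    using nn_expect_cosh_lincomb[where u=u, OF p u] by blast
  define r where "r = \<kappa> * norm h + 1"
  have "0 < r" using C(2) by (simp add: r_def add_nonneg_pos)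
  have "nn_expect M p (\<lambda>x. cosh (1 / r * lincomb u h x) - 1) < \<infinity>"
    using C(3)[rule_format, of r h] \<open>0 < r\<close> by (auto simp: r_def intro: le_less_trans)
  then have "\<exists>\<alpha>>0. nn_expect M p (\<lambda>x. cosh (\<alpha> * lincomb u h x) - 1) < \<infinity>"
    using \<open>0 < r\<close> by (intro exI[of _ "1/r"]) auto
  then show ?thesis
    by (simp add: orlicz_space_def expect_lincomb_eq_0[where u=u, OF p u])
qed

lemma orlicz_norm_lincomb_small:
  fixes u :: "'d::finite \<Rightarrow> 'a \<Rightarrow> real"
  assumes p: "p \<in> densities M" and u: "\<And>j. u j \<in> orlicz_space M p" and "0 < \<epsilon>"
  shows "\<exists>\<delta>>0. \<forall>h. norm h < \<delta> \<longrightarrow> orlicz_norm M p (lincomb u h) < \<epsilon>"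
proof -
  obtain C \<kappa> where C: "0 \<le> C" "0 < \<kappa>" "\<forall>h r. 0 < r \<longrightarrow> \<kappa> * norm h \<le> r \<longrightarrow>
    nn_expect M p (\<lambda>x. cosh (lincomb u h x / r) - 1) \<le> ennreal (C * (\<kappa> * norm h / r))"
    using nn_expect_cosh_lincomb[where u=u, OF p u] by blast
  define \<delta> where "\<delta> = \<epsilon> / 2 / (\<kappa> * (C + 1))"
  have "0 < \<delta>" using C \<open>0 < \<epsilon>\<close> by (simp add: \<delta>_def add_nonneg_pos)
  moreover have "orlicz_norm M p (lincomb u h) < \<epsilon>" if "norm h < \<delta>" for h
  proof -
    have *: "\<kappa> * norm h * (C + 1) \<le> \<epsilon> / 2"
      using that C(1,2) by (simp add: \<delta>_def pos_less_divide_eq add_nonneg_pos mult_ac)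
    have "0 \<le> \<kappa> * norm h" "0 \<le> C * (\<kappa> * norm h)" using C(1,2) by simp_all
    moreover have "\<kappa> * norm h * (C + 1) = C * (\<kappa> * norm h) + \<kappa> * norm h"
      by (simp add: algebra_simps)
    ultimately have "\<kappa> * norm h \<le> \<epsilon> / 2" "C * (\<kappa> * norm h) \<le> \<epsilon> / 2"
      using * by linarith+
    then have "nn_expect M p (\<lambda>x. cosh (lincomb u h x / (\<epsilon>/2)) - 1) \<le> ennreal (C * (\<kappa> * norm h / (\<epsilon>/2)))"
      and "C * (\<kappa> * norm h / (\<epsilon>/2)) \<le> 1"
      using C(3)[rule_format, of "\<epsilon>/2" h] \<open>0 < \<epsilon>\<close> by (simp_all add: field_simps)
    then have "nn_expect M p (\<lambda>x. cosh (lincomb u h x / (\<epsilon>/2)) - 1) \<le> 1"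
      by (metis ennreal_1 ennreal_leI order_trans)
    then have "orlicz_norm M p (lincomb u h) \<le> \<epsilon> / 2"
      unfolding orlicz_norm_def using \<open>0 < \<epsilon>\<close>
      by (intro cInf_lower) (auto intro!: bdd_belowI[of _ 0])
    then show ?thesis using \<open>0 < \<epsilon>\<close> by linarith
  qed
  ultimately show ?thesis by blast
qed

text \<open>The map from parameters to functions is continuous at \<open>\<theta>\<close> into the Orlicz space, so all parameters
  near an interior one have a finite partition function.\<close>

lemma integrable_exp_near:
  fixes u :: "'d::finite \<Rightarrow> 'a \<Rightarrow> real"
  assumes p: "p \<in> densities M" and u: "\<And>j. u j \<in> orlicz_space M p"
    and \<theta>: "\<theta> \<in> param_space M p u"
  shows "\<exists>\<delta>>0. \<forall>h. norm h < \<delta> \<longrightarrow> integrable M (\<lambda>x. exp (lincomb u (\<theta> + h) x) * p x)"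
proof -
  note [measurable] = densitiesD(1)[OF p]
  have [measurable]: "u j \<in> borel_measurable M" for j using u by (simp add: orlicz_space_def)
  obtain \<epsilon> where \<epsilon>: "0 < \<epsilon>" "\<And>v. v \<in> orlicz_space M p \<Longrightarrow>
      orlicz_norm M p (\<lambda>x. v x - lincomb u \<theta> x) < \<epsilon> \<Longrightarrow> v \<in> cumulant_dom M p"
    using \<theta> by (auto simp: param_space_def cumulant_dom_interior_def)
  obtain \<delta> where \<delta>: "0 < \<delta>" "\<forall>h. norm h < \<delta> \<longrightarrow> orlicz_norm M p (lincomb u h) < \<epsilon>"
    using orlicz_norm_lincomb_small[where u=u, OF p u \<epsilon>(1)] by blast
  have "integrable M (\<lambda>x. exp (lincomb u (\<theta> + h) x) * p x)" if "norm h < \<delta>" for h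
  proof (rule integrableI_nonneg)
    have "lincomb u (\<theta> + h) \<in> cumulant_dom M p"
      using \<delta>(2)[rule_format, OF that] lincomb_in_orlicz_space[where u=u, OF p u]
      by (intro \<epsilon>(2)) (simp_all add: lincomb_add cong: if_cong)
    then have "nn_expect M p (\<lambda>x. exp (lincomb u (\<theta> + h) x)) \<noteq> \<infinity>"
      by (auto simp: cumulant_dom_def cumulant_def Let_def)
    then show "(\<integral>\<^sup>+x. ennreal (exp (lincomb u (\<theta> + h) x) * p x) \<partial>M) < \<infinity>"
      by (simp add: nn_expect_def less_top)
    show "AE x in M. 0 \<le> exp (lincomb u (\<theta> + h) x) * p x"
      using densitiesD(3)[OF p] by (auto elim: eventually_mono)
  qed simp
  then show ?thesis using \<delta>(1) by blast
qed

text \<open>The logarithm can be undone because the partition function is positive: were it \<open>0\<close>, then \<open>p\<close>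
  would vanish almost everywhere, against its total mass \<open>1\<close>.\<close>

lemma exp_log_partition:
  assumes p: "p \<in> densities M" and [measurable]: "\<And>j. u j \<in> borel_measurable M"
    and int: "integrable M (\<lambda>x. exp (lincomb u \<theta> x) * p x)"
  shows "exp (log_partition M p u \<theta>) = (\<integral>x. exp (lincomb u \<theta> x) * p x \<partial>M)"
proof -
  note [measurable] = densitiesD(1)[OF p]
  let ?Z = "\<integral>x. exp (lincomb u \<theta> x) * p x \<partial>M"
  have nn: "AE x in M. 0 \<le> exp (lincomb u \<theta> x) * p x"
    using densitiesD(3)[OF p] by (auto elim: eventually_mono)
  have Z: "nn_expect M p (\<lambda>x. exp (lincomb u \<theta> x)) = ennreal ?Z"
    unfolding nn_expect_def by (rule nn_integral_eq_integral[OF int nn])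
  have "?Z \<noteq> 0"
  proof
    assume "?Z = 0"
    then have "AE x in M. p x = 0"
      using integral_nonneg_eq_0_iff_AE[OF int nn] by simp
    then have "(\<integral>x. p x \<partial>M) = 0" by (rule integral_eq_zero_AE)
    then show False using densitiesD(5)[OF p] by simp
  qed
  moreover have "0 \<le> ?Z" by (rule integral_nonneg_AE[OF nn])
  ultimately show ?thesis
    by (simp add: log_partition_def cumulant_def Z)
qed

lemma exp_density_in_densities:
  assumes p: "p \<in> densities M" and [measurable]: "\<And>j. u j \<in> borel_measurable M"
    and int: "integrable M (\<lambda>x. exp (lincomb u \<theta> x) * p x)"
  shows "exp_density M p u \<theta> \<in> densities M"
proof -
  note [measurable] = densitiesD(1)[OF p]
  have eq: "exp_density M p u \<theta> = (\<lambda>x. exp (- log_partition M p u \<theta>) * (exp (lincomb u \<theta> x) * p x))"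
    by (simp add: exp_density_def fun_eq_iff exp_diff exp_minus field_simps)
  show ?thesis
    unfolding densities_def eq using int densitiesD(2)[OF p]
    by (auto simp: exp_log_partition[where u=u, OF assms, symmetric] exp_minus elim: eventually_mono)
qed

lemma norm_axis_real: "norm (axis k s :: real^'d) = \<bar>s\<bar>"
  by (simp add: norm_eq_sqrt_inner inner_axis_axis)

text \<open>By \<open>exp \<bar>t\<bar> \<le> exp t + exp (- t)\<close> the exponential of a multiple of \<open>abs_sum u\<close> is dominated by the
  \<open>2d\<close> exponentials belonging to the parameters at distance \<open>r\<close> from \<open>\<theta>\<close> along the coordinate axes,
  all of which have a finite partition function.\<close>

lemma exp_moment_abs_sum:
  fixes u :: "'d::finite \<Rightarrow> 'a \<Rightarrow> real"
  assumes p: "p \<in> densities M" and u: "\<And>j. u j \<in> orlicz_space M p"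
    and \<theta>: "\<theta> \<in> param_space M p u"
  shows "\<exists>c>0. integrable (density M (exp_density M p u \<theta>)) (\<lambda>x. exp (c * abs_sum u x))"
proof -
  note [measurable] = densitiesD(1)[OF p]
  have [measurable]: "u j \<in> borel_measurable M" for j using u by (simp add: orlicz_space_def)
  obtain \<delta> where \<delta>: "0 < \<delta>" "\<And>h. norm h < \<delta> \<Longrightarrow> integrable M (\<lambda>x. exp (lincomb u (\<theta> + h) x) * p x)"
    using integrable_exp_near[where u=u, OF p u \<theta>] by auto
  define q where "q = exp_density M p u \<theta>"
  have q: "q \<in> densities M"
    unfolding q_def using \<delta>(1) \<delta>(2)[of 0] by (intro exp_density_in_densities[where u=u, OF p]) auto
  note [measurable] = densitiesD(1)[OF q]
  define r where "r = \<delta> / 2"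
  define c where "c = r / real CARD('d)"
  have "0 < r" "0 < c" using \<delta>(1) by (simp_all add: r_def c_def)
  let ?e = "\<lambda>k s x. exp (lincomb u (\<theta> + axis k s) x) * p x"
  have "integrable M (\<lambda>x. q x *\<^sub>R exp (c * abs_sum u x))"
  proof (rule Bochner_Integration.integrable_bound)
    show "integrable M (\<lambda>x. exp (- log_partition M p u \<theta>) * (\<Sum>k\<in>UNIV. ?e k r x + ?e k (-r) x))"
      using \<delta> by (intro integrable_mult_right Bochner_Integration.integrable_sum
          Bochner_Integration.integrable_add \<delta>(2)) (auto simp: norm_axis_real r_def)
    show "AE x in M. norm (q x *\<^sub>R exp (c * abs_sum u x))
        \<le> norm (exp (- log_partition M p u \<theta>) * (\<Sum>k\<in>UNIV. ?e k r x + ?e k (-r) x))"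
      using densitiesD(3)[OF p]
    proof (rule AE_mp, intro AE_I2 impI)
      fix x assume px: "0 \<le> p x"
      let ?K = "exp (- log_partition M p u \<theta>)"
      obtain k where k: "abs_sum u x \<le> real CARD('d) * \<bar>u k x\<bar>" by (rule abs_sum_le_card_mult)
      have "c * abs_sum u x \<le> r * \<bar>u k x\<bar>"
        using mult_left_mono[OF k, of c] \<open>0 < c\<close> by (simp add: c_def)
      then have "exp (c * abs_sum u x) \<le> exp (r * \<bar>u k x\<bar>)" by simp
      also have "\<dots> \<le> exp (r * u k x) + exp (- r * u k x)" by (simp add: abs_if)
      finally have "q x * exp (c * abs_sum u x) \<le> q x * (exp (r * u k x) + exp (- r * u k x))"
        using px by (intro mult_left_mono) (auto simp: q_def exp_density_def)
      also have "\<dots> = ?K * (?e k r x + ?e k (-r) x)"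
        by (simp add: q_def exp_density_def lincomb_add lincomb_axis exp_add exp_diff exp_minus field_simps)
      also have "\<dots> \<le> ?K * (\<Sum>k\<in>UNIV. ?e k r x + ?e k (-r) x)"
        using px by (intro mult_left_mono member_le_sum) auto
      finally show "norm (q x *\<^sub>R exp (c * abs_sum u x))
        \<le> norm (?K * (\<Sum>k\<in>UNIV. ?e k r x + ?e k (-r) x))"
        using px by (simp add: q_def exp_density_def)
    qed
  qed simp
  then have "integrable (density M q) (\<lambda>x. exp (c * abs_sum u x))"
    by (subst integrable_density) (auto simp: densitiesD[OF q])
  then show ?thesis using \<open>0 < c\<close> by (auto simp: q_def)
qed

section \<open>Derivatives of expectations along the exponential family\<close>

lemma has_derivative_vec:
  fixes f :: "'a::real_normed_vector \<Rightarrow> 'b::euclidean_space^'n"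
  assumes "\<And>i. ((\<lambda>x. f x $ i) has_derivative (\<lambda>h. f' h $ i)) (at a)"
  shows "(f has_derivative f') (at a)"
proof (subst has_derivative_componentwise_within, intro ballI)
  fix b :: "'b^'n" assume "b \<in> Basis"
  then obtain i v where "b = axis i v" by (auto simp: Basis_vec_def)
  then show "((\<lambda>x. f x \<bullet> b) has_derivative (\<lambda>h. f' h \<bullet> b)) (at a)"
    using has_derivative_inner_left[OF assms[of i], of v] by (simp add: inner_axis)
qed

lemma partial_deriv_eq:
  assumes "(f has_derivative f') (at \<theta>)"
  shows "partial_deriv f \<theta> j = f' (axis j 1)"
proof -
  have "((\<lambda>t. \<theta> + t *\<^sub>R axis j 1) has_derivative (\<lambda>t. t *\<^sub>R axis j (1::real))) (at 0)"
    by (auto intro!: derivative_eq_intros)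
  then have "((\<lambda>t. f (\<theta> + t *\<^sub>R axis j 1)) has_derivative (\<lambda>t. f' (t *\<^sub>R axis j 1))) (at 0)"
    by (rule has_derivative_compose) (use assms in simp)
  then have "((\<lambda>t. f (\<theta> + t *\<^sub>R axis j 1)) has_vector_derivative f' (axis j 1)) (at 0)"
    by (simp add: has_vector_derivative_def linear_scale[OF has_derivative_linear[OF assms]])
  then show ?thesis
    unfolding partial_deriv_def by (rule vector_derivative_at)
qed

lemma sum_components_linear:
  fixes D :: "real^'d \<Rightarrow> 'b::real_vector"
  assumes "linear D"
  shows "(\<Sum>j\<in>UNIV. h$j *\<^sub>R D (axis j 1)) = D h"
proof -
  have "D h = D (\<Sum>j\<in>UNIV. h$j *\<^sub>R axis j 1)"
    using basis_expansion[of h] by (simp add: scalar_mult_eq_scaleR)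
  then show ?thesis by (simp add: linear_sum[OF assms] linear_scale[OF assms])
qed

lemma exp_density_add:
  "exp_density M p u (\<theta> + h) x =
     exp (log_partition M p u \<theta> - log_partition M p u (\<theta> + h)) * (exp (lincomb u h x) * exp_density M p u \<theta> x)"
  by (simp add: exp_density_def lincomb_add exp_add exp_diff field_simps)

text \<open>Relative to the density at \<open>\<theta>\<close>, the density at \<open>\<theta> + h\<close> is an exponential tilt. The log-partition
  function only normalizes, so it cancels from the quotient and never has to be differentiated.\<close>

lemma expect_exp_density_add:
  assumes p: "p \<in> densities M" and [measurable]: "\<And>j. u j \<in> borel_measurable M"
    and int: "integrable M (\<lambda>x. exp (lincomb u (\<theta> + h) x) * p x)"
  shows "expect M (exp_density M p u (\<theta> + h)) f =
    expect M (exp_density M p u \<theta>) (\<lambda>x. f x * exp (lincomb u h x))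
      / expect M (exp_density M p u \<theta>) (\<lambda>x. exp (lincomb u h x))"
proof -
  let ?K = "exp (log_partition M p u \<theta> - log_partition M p u (\<theta> + h))"
  have eq: "expect M (exp_density M p u (\<theta> + h)) f =
      ?K * expect M (exp_density M p u \<theta>) (\<lambda>x. f x * exp (lincomb u h x))" for f
    unfolding expect_def exp_density_add
    by (simp only: mult.left_commute[of _ ?K] integral_mult_right_zero mult.assoc)
  have "expect M (exp_density M p u (\<theta> + h)) (\<lambda>_. 1) = 1"
    using densitiesD(5)[OF exp_density_in_densities[where u=u, OF p _ int]] by (simp add: expect_def)
  then have "?K = 1 / expect M (exp_density M p u \<theta>) (\<lambda>x. exp (lincomb u h x))"
    by (simp add: eq[of "\<lambda>_. 1"] eq_divide_eq)
       (metis mult_zero_right zero_neq_one)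
  then show ?thesis by (simp add: eq)
qed

text \<open>The facts about the family near \<open>\<theta>\<close> that the geometry needs, obtained together because they share
  the choice of \<open>c\<close>. Functions of polynomial growth in the \<open>u\<^sub>j\<close> are integrable, and differentiating
  the expectation of such a function in direction \<open>j\<close> gives its covariance with \<open>u\<^sub>j\<close>.\<close>

lemma exp_family_at:
  fixes u :: "'d::finite \<Rightarrow> 'a \<Rightarrow> real"
  assumes p: "p \<in> densities M" and u: "\<And>j. u j \<in> orlicz_space M p"
    and \<theta>: "\<theta> \<in> param_space M p u"
  shows exp_density_at: "exp_density M p u \<theta> \<in> densities M"
    and integrable_at: "\<And>f n. f \<in> borel_measurable M \<Longrightarrow> (\<And>x. \<bar>f x\<bar> \<le> abs_sum u x ^ n) \<Longrightarrow>
      integrable (density M (exp_density M p u \<theta>)) f"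
    and has_derivative_expect: "\<And>f n. f \<in> borel_measurable M \<Longrightarrow> (\<And>x. \<bar>f x\<bar> \<le> abs_sum u x ^ n) \<Longrightarrow>
      ((\<lambda>\<theta>. expect M (exp_density M p u \<theta>) f) has_derivative
        (\<lambda>h. \<Sum>j\<in>UNIV. h$j * (expect M (exp_density M p u \<theta>) (\<lambda>x. f x * u j x)
           - expect M (exp_density M p u \<theta>) f * expect M (exp_density M p u \<theta>) (u j)))) (at \<theta>)"
proof -
  have um[measurable]: "u j \<in> borel_measurable M" for j using u by (simp add: orlicz_space_def)
  obtain \<delta> where \<delta>: "0 < \<delta>" "\<forall>h. norm h < \<delta> \<longrightarrow> integrable M (\<lambda>x. exp (lincomb u (\<theta> + h) x) * p x)"
    using integrable_exp_near[where u=u, OF p u \<theta>] by auto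
  define q where "q = exp_density M p u \<theta>"
  show q: "exp_density M p u \<theta> \<in> densities M"
    using \<delta>(1) \<delta>(2)[rule_format, of 0] by (intro exp_density_in_densities[OF p]) auto
  note q = q[folded q_def]
  define P where "P = density M q"
  interpret prob_space P unfolding P_def by (rule prob_space_density_densities[OF q])
  have umP[measurable]: "u j \<in> borel_measurable P" for j by (simp add: P_def)
  obtain c where c: "0 < c" "integrable P (\<lambda>x. exp (c * abs_sum u x))"
    using exp_moment_abs_sum[where u=u, OF p u \<theta>] by (auto simp: P_def q_def)
  have growth: "integrable P (\<lambda>x. f x * exp (c/2 * abs_sum u x))"
    if "f \<in> borel_measurable M" "\<And>x. \<bar>f x\<bar> \<le> abs_sum u x ^ n" for f n
    by (rule integrable_growth[where u=u, OF _ _ c that(2)]) (use that in \<open>auto simp: P_def\<close>)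
  have int: "integrable P f"
    if [measurable]: "f \<in> borel_measurable M" and "\<And>x. \<bar>f x\<bar> \<le> abs_sum u x ^ n" for f n
  proof (rule Bochner_Integration.integrable_bound[OF growth[OF that]])
    show "AE x in P. norm (f x) \<le> norm (f x * exp (c/2 * abs_sum u x))"
      using c(1) abs_sum_nonneg[of u] by (simp add: abs_mult mult_le_cancel_left1)
  qed (simp add: P_def)
  show "integrable (density M (exp_density M p u \<theta>)) f"
    if "f \<in> borel_measurable M" "\<And>x. \<bar>f x\<bar> \<le> abs_sum u x ^ n" for f n
    using int[OF that] by (simp add: P_def q_def)
  have E: "expect M q f = (\<integral>x. f x \<partial>P)" if "f \<in> borel_measurable M" for f
    unfolding P_def by (rule expect_eq_integral_density[OF q that])
  fix f :: "'a \<Rightarrow> real" and n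
  assume f[measurable]: "f \<in> borel_measurable M" and fn: "\<And>x. \<bar>f x\<bar> \<le> abs_sum u x ^ n"
  let ?g = "\<lambda>h. (\<integral>x. f x * exp (lincomb u h x) \<partial>P) / (\<integral>x. exp (lincomb u h x) \<partial>P)"
  let ?g' = "\<lambda>h. (\<integral>x. f x * lincomb u h x \<partial>P) - (\<integral>x. f x \<partial>P) * (\<integral>x. lincomb u h x \<partial>P)"
  have "(?g has_derivative ?g') (at 0)"
  proof (rule has_derivative_tilted_mean[where c="c/2"])
    show "f \<in> borel_measurable P" by (simp add: P_def)
    show "integrable P (\<lambda>x. exp (c/2 * abs_sum u x))" using growth[of "\<lambda>_. 1" 0] by simp
  qed (use c(1) umP growth[OF f fn] prob_space_axioms in simp_all)
  then have "(?g has_derivative ?g') (at (\<theta> - \<theta>))" by simp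
  then have "((\<lambda>\<theta>'. ?g (\<theta>' - \<theta>)) has_derivative ?g') (at \<theta>)"
    by (intro has_derivative_compose[where f="\<lambda>\<theta>'. \<theta>' - \<theta>" and f'="\<lambda>h. h" and g="?g"])
       (auto intro!: derivative_eq_intros)
  moreover have "\<forall>\<^sub>F \<theta>' in at \<theta>. ?g (\<theta>' - \<theta>) = expect M (exp_density M p u \<theta>') f"
    unfolding eventually_at
  proof (intro exI[of _ \<delta>] conjI ballI impI \<delta>(1))
    fix \<theta>' assume "\<theta>' \<noteq> \<theta> \<and> dist \<theta>' \<theta> < \<delta>"
    then have "integrable M (\<lambda>x. exp (lincomb u (\<theta> + (\<theta>' - \<theta>)) x) * p x)"
      by (intro \<delta>(2)[rule_format]) (simp add: dist_norm)
    from expect_exp_density_add[where u=u, OF p um this, of f]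
    show "?g (\<theta>' - \<theta>) = expect M (exp_density M p u \<theta>') f"
      by (simp add: q_def[symmetric] E)
  qed
  ultimately have "((\<lambda>\<theta>'. expect M (exp_density M p u \<theta>') f) has_derivative ?g') (at \<theta>)"
    by (rule has_derivative_transform_eventually) (simp_all add: q_def[symmetric] E prob_space)
  moreover have "?g' h = (\<Sum>j\<in>UNIV. h$j * (expect M q (\<lambda>x. f x * u j x) - expect M q f * expect M q (u j)))" for h
  proof -
    have fu: "integrable P (\<lambda>x. f x * u j x)" for j
    proof (rule int[of _ "Suc n"])
      show "\<bar>f x * u j x\<bar> \<le> abs_sum u x ^ Suc n" for x
        using mult_mono[OF fn[of x] component_le_abs_sum[of u j x]] abs_sum_nonneg[of u x]
        by (simp add: abs_mult mult.commute)
    qed simp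
    have u1: "integrable P (u j)" for j
      by (rule int[of _ 1]) (simp_all add: component_le_abs_sum)
    have "(\<integral>x. f x * lincomb u h x \<partial>P) = (\<Sum>j\<in>UNIV. h$j * (\<integral>x. f x * u j x \<partial>P))"
    proof -
      have "f x * lincomb u h x = (\<Sum>j\<in>UNIV. h$j * (f x * u j x))" for x
        by (simp add: lincomb_def sum_distrib_left mult.left_commute)
      then show ?thesis using fu by simp
    qed
    moreover have "(\<integral>x. lincomb u h x \<partial>P) = (\<Sum>j\<in>UNIV. h$j * (\<integral>x. u j x \<partial>P))"
      using u1 by (simp add: lincomb_def)
    ultimately show ?thesis
      by (simp add: E right_diff_distrib sum_subtractf sum_distrib_left mult_ac)
  qed
  ultimately show "((\<lambda>\<theta>. expect M (exp_density M p u \<theta>) f) has_derivative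
        (\<lambda>h. \<Sum>j\<in>UNIV. h$j * (expect M (exp_density M p u \<theta>) (\<lambda>x. f x * u j x)
           - expect M (exp_density M p u \<theta>) f * expect M (exp_density M p u \<theta>) (u j)))) (at \<theta>)"
    by (simp add: q_def)
qed

section \<open>The Fisher matrix\<close>

text \<open>The Fisher matrix is the Schur complement required by \<open>bordered_left_inverse\<close>: this is why its inverse occurs in
  the inverse of \<open>S\<close>.\<close>

lemma fisher_eq_moment2_minus_outer:
  fixes u :: "'d::finite \<Rightarrow> 'a \<Rightarrow> real"
  assumes p: "p \<in> densities M" and u: "\<And>j. u j \<in> orlicz_space M p"
    and \<theta>: "\<theta> \<in> param_space M p u"
  shows "fisher M p u \<theta> = moment2 M p u \<theta> - outer (eta M p u \<theta>) (eta M p u \<theta>)"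
proof -
  have [measurable]: "u j \<in> borel_measurable M" for j using u by (simp add: orlicz_space_def)
  define q where "q = exp_density M p u \<theta>"
  note q = exp_density_at[where u=u, OF p u \<theta>, folded q_def]
  note int = integrable_at[where u=u, OF p u \<theta>, folded q_def]
  interpret prob_space "density M q" by (rule prob_space_density_densities[OF q])
  have E: "expect M q f = (\<integral>x. f x \<partial>density M q)" if "f \<in> borel_measurable M" for f
    by (rule expect_eq_integral_density[OF q that])
  have i1: "integrable (density M q) (u j)" for j
    by (rule int[of _ 1]) (simp_all add: component_le_abs_sum)
  have i2: "integrable (density M q) (\<lambda>x. u j x * u k x)" for j k
    by (rule int[of _ 2])
       (simp_all add: abs_mult power2_eq_square mult_mono component_le_abs_sum abs_sum_nonneg)
  have "cov M q (u j) (u k) = expect M q (\<lambda>x. u j x * u k x) - expect M q (u j) * expect M q (u k)" for j k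
  proof -
    let ?a = "expect M q (u j)" and ?b = "expect M q (u k)"
    have "cov M q (u j) (u k) = (\<integral>x. u j x * u k x - ?b * u j x - ?a * u k x + ?a * ?b \<partial>density M q)"
      unfolding cov_def by (subst E) (auto simp: algebra_simps)
    also have "\<dots> = (\<integral>x. u j x * u k x \<partial>density M q) - ?b * (\<integral>x. u j x \<partial>density M q)
        - ?a * (\<integral>x. u k x \<partial>density M q) + ?a * ?b"
      using i1 i2 prob_space by simp
    finally show ?thesis by (simp add: E)
  qed
  then show ?thesis
    by (simp add: vec_eq_iff fisher_def moment2_def eta_def outer_def q_def)
qed

lemma fisher_quadratic_form:
  fixes u :: "'d::finite \<Rightarrow> 'a \<Rightarrow> real"
  assumes p: "p \<in> densities M" and u: "\<And>j. u j \<in> orlicz_space M p"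
    and \<theta>: "\<theta> \<in> param_space M p u"
  defines "P \<equiv> density M (exp_density M p u \<theta>)"
  shows "integrable P (\<lambda>x. (lincomb u h x - eta M p u \<theta> \<bullet> h)\<^sup>2)"
    and "h \<bullet> (fisher M p u \<theta> *v h) = (\<integral>x. (lincomb u h x - eta M p u \<theta> \<bullet> h)\<^sup>2 \<partial>P)"
proof -
  have [measurable]: "u j \<in> borel_measurable M" for j using u by (simp add: orlicz_space_def)
  define q where "q = exp_density M p u \<theta>"
  note q = exp_density_at[where u=u, OF p u \<theta>, folded q_def]
  note int = integrable_at[where u=u, OF p u \<theta>, folded q_def]
  interpret prob_space P unfolding P_def q_def[symmetric] by (rule prob_space_density_densities[OF q])
  define w where "w = (\<lambda>j x. u j x - eta M p u \<theta> $ j)"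
  have i1: "integrable P (u j)" for j
    unfolding P_def q_def[symmetric] by (rule int[of _ 1]) (simp_all add: component_le_abs_sum)
  have i2: "integrable P (\<lambda>x. u j x * u k x)" for j k
    unfolding P_def q_def[symmetric] by (rule int[of _ 2])
       (simp_all add: abs_mult power2_eq_square mult_mono component_le_abs_sum abs_sum_nonneg)
  have iw: "integrable P (\<lambda>x. w j x * w k x)" for j k
    using i1 i2 by (simp add: w_def left_diff_distrib right_diff_distrib)
  have F: "fisher M p u \<theta> $ j $ k = (\<integral>x. w j x * w k x \<partial>P)" for j k
    by (simp add: fisher_def cov_def eta_def w_def P_def q_def[symmetric] expect_eq_integral_density[OF q])
  have sq: "(lincomb u h x - eta M p u \<theta> \<bullet> h)\<^sup>2 = (\<Sum>j\<in>UNIV. \<Sum>k\<in>UNIV. h$j * (h$k * (w j x * w k x)))" for x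
  proof -
    have "lincomb u h x - eta M p u \<theta> \<bullet> h = (\<Sum>j\<in>UNIV. h$j * w j x)"
      by (simp add: lincomb_def w_def inner_vec_def sum_subtractf right_diff_distrib mult.commute)
    then show ?thesis by (simp add: power2_eq_square sum_product mult_ac)
  qed
  show "integrable P (\<lambda>x. (lincomb u h x - eta M p u \<theta> \<bullet> h)\<^sup>2)"
    unfolding sq using iw by simp
  show "h \<bullet> (fisher M p u \<theta> *v h) = (\<integral>x. (lincomb u h x - eta M p u \<theta> \<bullet> h)\<^sup>2 \<partial>P)"
    unfolding sq using iw
    by (simp add: inner_vec_def matrix_vector_mult_def F sum_distrib_left mult_ac)
qed

text \<open>A kernel vector \<open>h\<close> makes the variance of \<open>\<Sum>\<^sub>j h\<^sub>j u\<^sub>j\<close> vanish, so this function is almost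
  everywhere constant. Elements of the Orlicz space are centred with respect to \<open>p\<close>, so the constant is
  \<open>0\<close> and linear independence applies.\<close>

lemma fisher_kernel_trivial:
  fixes u :: "'d::finite \<Rightarrow> 'a \<Rightarrow> real"
  assumes p: "p \<in> densities M" and u: "\<And>j. u j \<in> orlicz_space M p"
    and indep: "lin_indep_L2 M p u" and \<theta>: "\<theta> \<in> param_space M p u"
    and ker: "fisher M p u \<theta> *v h = 0"
  shows "h = 0"
proof -
  have um[measurable]: "u j \<in> borel_measurable M" for j using u by (simp add: orlicz_space_def)
  note pm[measurable] = densitiesD(1)[OF p]
  define q where "q = exp_density M p u \<theta>"
  note q = exp_density_at[where u=u, OF p u \<theta>, folded q_def]
  note qm[measurable] = densitiesD(1)[OF q]
  let ?m = "eta M p u \<theta> \<bullet> h"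
  have "(\<integral>x. (lincomb u h x - ?m)\<^sup>2 \<partial>density M q) = 0"
    using fisher_quadratic_form(2)[where u=u, OF p u \<theta>, of h] ker by (simp add: q_def)
  then have "AE x in density M q. (lincomb u h x - ?m)\<^sup>2 = 0"
    using fisher_quadratic_form(1)[where u=u, OF p u \<theta>, of h]
    by (subst (asm) integral_nonneg_eq_0_iff_AE) (simp_all add: q_def)
  then have "AE x in M. 0 < q x \<longrightarrow> lincomb u h x = ?m"
    by (simp add: AE_density)
  then have const: "AE x in M. lincomb u h x = ?m"
    using densitiesD(2)[OF q] by eventually_elim simp
  have "0 = expect M p (lincomb u h)"
    by (simp add: expect_lincomb_eq_0[where u=u, OF p u])
  also have "\<dots> = (\<integral>x. ?m * p x \<partial>M)"
    unfolding expect_def using const by (intro integral_cong_AE) (auto elim: eventually_mono)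
  also have "\<dots> = ?m" by (simp add: densitiesD(5)[OF p])
  finally have "AE x in density M p. lincomb u h x = 0"
    using const by (simp add: AE_density) (auto elim: eventually_mono)
  then show "h = 0" using indep by (simp add: lin_indep_L2_def)
qed

lemma fisher_matrix_inv:
  fixes u :: "'d::finite \<Rightarrow> 'a \<Rightarrow> real"
  assumes p: "p \<in> densities M" and u: "\<And>j. u j \<in> orlicz_space M p"
    and indep: "lin_indep_L2 M p u" and \<theta>: "\<theta> \<in> param_space M p u"
  shows "matrix_inv (fisher M p u \<theta>) ** fisher M p u \<theta> = mat 1"
proof -
  have "\<forall>h. fisher M p u \<theta> *v h = 0 \<longrightarrow> h = 0"
    using fisher_kernel_trivial[where u=u, OF p u indep \<theta>] by blast
  then obtain B where "B ** fisher M p u \<theta> = mat 1"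
    by (auto simp: matrix_left_invertible_ker[symmetric])
  then show ?thesis by (simp add: matrix_inv_eqI)
qed

section \<open>The pullback of the affine-invariant metric\<close>

theorem theorem5p5:
  fixes M :: "'a measure"
    and p :: "'a \<Rightarrow> real"
    and u :: "'d::finite \<Rightarrow> 'a \<Rightarrow> real"
    and \<theta> :: "real^'d"
  assumes "sigma_finite_measure M"
    and "p \<in> densities M"
    and "\<And>j. u j \<in> orlicz_space M p"
    and "lin_indep_L2 M p u"
    and "\<theta> \<in> param_space M p u"
  shows "embed_param M p u \<theta> = bordered (moment2 M p u \<theta>) (eta M p u \<theta>)
    \<and> moment2 M p u differentiable (at \<theta>)
    \<and> eta M p u differentiable (at \<theta>)
    \<and> (let E = expect M (exp_density M p u \<theta>) in
        \<forall>j l m. partial_deriv (moment2 M p u) \<theta> j $ l $ m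
          = E (\<lambda>x. u j x * u l x * u m x) - E (u j) * E (\<lambda>x. u l x * u m x))
    \<and> (\<forall>j. partial_deriv (eta M p u) \<theta> j = fisher M p u \<theta> *v axis j 1)
    \<and> (\<forall>h. frechet_derivative (eta M p u) (at \<theta>) h = fisher M p u \<theta> *v h)
    \<and> (\<forall>h. let J = matrix_inv (fisher M p u \<theta>);
              e = eta M p u \<theta>;
              de = frechet_derivative (eta M p u) (at \<theta>) h;
              dA = (\<Sum>j\<in>UNIV. h$j *\<^sub>R partial_deriv (moment2 M p u) \<theta> j);
              \<gamma> = 1 + e \<bullet> (J *v e)
          in line_element M p u \<theta> h
             = 1/2 * trace (J ** dA ** J ** dA)
               - 2 * (e \<bullet> ((J ** dA ** J) *v de))
               + (e \<bullet> (J *v de))\<^sup>2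
               + \<gamma> * (de \<bullet> (J *v de)))"
proof -
  note p = assms(2) and u = assms(3) and indep = assms(4) and \<theta> = assms(5)
  have [measurable]: "u j \<in> borel_measurable M" for j using u by (simp add: orlicz_space_def)
  define E where "E = expect M (exp_density M p u \<theta>)"
  define e where "e = eta M p u \<theta>"
  define A where "A = moment2 M p u \<theta>"
  define I where "I = fisher M p u \<theta>"
  define J where "J = matrix_inv I"
  note deriv = has_derivative_expect[where u=u, OF p u \<theta>, folded E_def]
  have E1: "E (\<lambda>_. 1) = 1"
    using densitiesD(5)[OF exp_density_at[where u=u, OF p u \<theta>]] by (simp add: E_def expect_def)
  have A_nth: "A $ l $ m = E (\<lambda>x. u l x * u m x)" and e_nth: "e $ l = E (u l)" for l m
    by (simp_all add: A_def e_def moment2_def eta_def E_def)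
  have I_eq: "I = A - outer e e"
    unfolding I_def A_def e_def by (rule fisher_eq_moment2_minus_outer[where u=u, OF p u \<theta>])
  have symA: "transpose A = A" by (simp add: vec_eq_iff transpose_def A_nth mult.commute)
  have symI: "transpose I = I"
    by (simp add: vec_eq_iff transpose_def I_eq A_nth outer_def mult.commute)
  have JI: "J ** I = mat 1"
    unfolding J_def I_def by (rule fisher_matrix_inv[where u=u, OF p u indep \<theta>])
  have symJ: "transpose J = J" by (rule transpose_matrix_inv[OF JI symI])

  have S: "embed_param M p u \<theta> = bordered A e"
    unfolding bordered_eq_block mat_eq_block_iff
    by (simp add: embed_param_def embed_def augmented_def A_nth e_nth E_def[symmetric] E1)

  define DA where "DA = (\<lambda>h::real^'d. \<chi> l m.
    \<Sum>j\<in>UNIV. h$j * (E (\<lambda>x. u l x * u m x * u j x) - E (\<lambda>x. u l x * u m x) * E (u j)))"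
  have dE1: "((\<lambda>\<theta>. expect M (exp_density M p u \<theta>) (u l)) has_derivative (\<lambda>h. (I *v h) $ l)) (at \<theta>)" for l
  proof -
    have "(\<Sum>j\<in>UNIV. h$j * (E (\<lambda>x. u l x * u j x) - E (u l) * E (u j))) = (I *v h) $ l" for h
      by (simp add: I_eq matrix_vector_mult_def A_nth e_nth outer_def mult.commute)
    then show ?thesis using deriv[of "u l" 1] by (simp add: component_le_abs_sum)
  qed
  have dE2: "((\<lambda>\<theta>. expect M (exp_density M p u \<theta>) (\<lambda>x. u l x * u m x)) has_derivative (\<lambda>h. DA h $ l $ m)) (at \<theta>)" for l m
    using deriv[of "\<lambda>x. u l x * u m x" 2]
    by (simp add: DA_def abs_mult power2_eq_square mult_mono component_le_abs_sum abs_sum_nonneg)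
  \<comment> \<open>The corner of \<open>S\<close> is the expectation of \<open>1\<close>. It equals \<open>1\<close> only where the partition function is
      finite, which near \<open>\<theta>\<close> is part of what \<open>deriv\<close> rests on.\<close>
  have dE0: "((\<lambda>\<theta>. expect M (exp_density M p u \<theta>) (\<lambda>_. 1)) has_derivative (\<lambda>h. 0)) (at \<theta>)"
    using deriv[of "\<lambda>_. 1" 0] by (simp add: E1)
  have d_eta: "(eta M p u has_derivative (\<lambda>h. I *v h)) (at \<theta>)"
    by (rule has_derivative_vec) (simp add: eta_def dE1)
  have d_A: "(moment2 M p u has_derivative DA) (at \<theta>)"
    by (intro has_derivative_vec) (simp add: moment2_def dE2)
  have d_S: "(embed_param M p u has_derivative (\<lambda>h. block (DA h) (I *v h) (I *v h) 0)) (at \<theta>)"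
  proof (intro has_derivative_vec)
    fix i j :: "'d + unit"
    show "((\<lambda>\<theta>. embed_param M p u \<theta> $ i $ j) has_derivative (\<lambda>h. block (DA h) (I *v h) (I *v h) 0 $ i $ j)) (at \<theta>)"
      using dE0 dE1 dE2 by (cases i; cases j) (simp_all add: embed_param_def embed_def augmented_def)
  qed

  have frechet: "frechet_derivative (eta M p u) (at \<theta>) = (\<lambda>h. I *v h)"
    using frechet_derivative_at[OF d_eta] by simp
  have dA: "(\<Sum>j\<in>UNIV. h$j *\<^sub>R partial_deriv (moment2 M p u) \<theta> j) = DA h" for h
    unfolding partial_deriv_eq[OF d_A]
    by (rule sum_components_linear[OF has_derivative_linear[OF d_A]])
  have partial_A: "partial_deriv (moment2 M p u) \<theta> j $ l $ m
      = E (\<lambda>x. u j x * u l x * u m x) - E (u j) * E (\<lambda>x. u l x * u m x)" for j l m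
  proof -
    have "DA (axis j 1) $ l $ m
        = (\<Sum>k\<in>UNIV. if k = j then E (\<lambda>x. u l x * u m x * u k x) - E (\<lambda>x. u l x * u m x) * E (u k) else 0)"
      unfolding DA_def vec_lambda_beta by (intro sum.cong) (auto simp: axis_def)
    also have "\<dots> = E (\<lambda>x. u j x * u l x * u m x) - E (u j) * E (\<lambda>x. u l x * u m x)"
      by (simp add: mult_ac)
    finally show ?thesis by (simp add: partial_deriv_eq[OF d_A])
  qed

  have line: "line_element M p u \<theta> h
      = 1/2 * trace (J ** DA h ** J ** DA h) - 2 * (e \<bullet> ((J ** DA h ** J) *v (I *v h)))
        + (e \<bullet> (J *v (I *v h)))\<^sup>2 + (1 + e \<bullet> (J *v e)) * ((I *v h) \<bullet> (J *v (I *v h)))" for h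
  proof -
    define X where "X = block J (-(J *v e)) (-(J *v e)) (1 + e \<bullet> (J *v e)) ** block (DA h) (I *v h) (I *v h) 0"
    have inv: "matrix_inv (bordered A e) = block J (-(J *v e)) (-(J *v e)) (1 + e \<bullet> (J *v e))"
      using JI by (intro matrix_inv_eqI bordered_left_inverse symA symJ) (simp add: I_eq)
    have "line_element M p u \<theta> h = airm (bordered A e)
        (\<Sum>j\<in>UNIV. h$j *\<^sub>R partial_deriv (embed_param M p u) \<theta> j)
        (\<Sum>j\<in>UNIV. h$j *\<^sub>R partial_deriv (embed_param M p u) \<theta> j)"
      unfolding line_element_def pullback_metric_def vec_lambda_beta S by (rule airm_sum)
    also have "(\<Sum>j\<in>UNIV. h$j *\<^sub>R partial_deriv (embed_param M p u) \<theta> j) = block (DA h) (I *v h) (I *v h) 0"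
      unfolding partial_deriv_eq[OF d_S]
      by (rule sum_components_linear[OF has_derivative_linear[OF d_S]])
    also have "airm (bordered A e) \<dots> \<dots> = 1/2 * trace (X ** X)"
      by (simp add: airm_def inv X_def matrix_mul_assoc)
    also have "trace (X ** X) = trace (J ** DA h ** J ** DA h) - 4 * (e \<bullet> ((J ** DA h ** J) *v (I *v h)))
      + 2 * (e \<bullet> (J *v (I *v h)))\<^sup>2 + 2 * ((1 + e \<bullet> (J *v e)) * ((I *v h) \<bullet> (J *v (I *v h))))"
      unfolding X_def
      by (rule trace_bordered_square[OF symJ]) (simp add: vec_eq_iff transpose_def DA_def mult.commute)
    finally show ?thesis by (simp add: algebra_simps)
  qed

  show ?thesis
    unfolding Let_def A_def[symmetric] e_def[symmetric] E_def[symmetric] I_def[symmetric]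
      J_def[symmetric] frechet dA
    using S d_A d_eta partial_A line by (auto simp: differentiable_def partial_deriv_eq[OF d_eta])
qed

end
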